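(* Let $\mathcal A\subset\mathbb R^3$ be an Antoine's necklace. There exists a convex body $K_{\mathcal A}\subset\mathbb R^3$ such that $p_\ell(\mathcal A)=p_\ell(K_{\mathcal A})$ for each straight line $\ell\subset\mathbb R^3$.
   Context: A convex body in $\mathbb R^3$ is a compact convex set with non-empty interior in $\mathbb R^3$. $p_\ell:\mathbb R^3\to\ell$ is the orthogonal projection onto the line $\ell$. A Cantor set is any topological space homeomorphic to the standard middle-thirds Cantor set. A circle in $\mathbb R^3$ is a round circle. $\operatorname{Int}$ denotes the interior of a manifold-with-boundary. Standard solid torus: let $P\subset\mathbb R^3$ be a $2$-plane, $D\subset P$ a disk of radius $r>0$ with center $Q$, and $\ell_0\subset P$ a straight line at distance $d(Q,\ell_0)=R>r$ from $Q$. A standard solid torus is the solid torus of revolution generated by revolving such a $D$ in $\mathbb R^3$ about $\ell_0$. Its central circle is the circle generated by $Q$; its center is the center of its central circle. Two disjoint standard solid tori are linked if their central circles are linked (linking number $\pm1$). Simple chain: a simple chain in a standard solid torus $T\subset\mathbb R^3$ is a finite family $T_1,\dots,T_q$, $q\geqslant 3$, of pairwise disjoint congruent standard solid tori such that (1) $T_1\cup\dots\cup T_q\subset\operatorname{Int}T$; (2) the centers of $T_1,\dots,T_q$ are subsequent vertices of a regular convex $q$-gon inscribed in the central circle of $T$; (3) for $i\ne j$, $T_i$ and $T_j$ are linked if $i-j\equiv\pm1 \pmod q$, and are not linked otherwise; (4) for each $i$, the central circle of $T_i$ is null-homotopic in $T$. Antoine's necklace: a Cantor set in $\mathbb R^3$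 which can be obtained as an intersection $\mathcal A=\bigcap_{i=1}^\infty M_i$, where each $M_i$ is the union of a finite number of pairwise disjoint standard solid tori such that (1) $M_1$ is a standard solid torus; (2) $M_{i+1}\subset\operatorname{Int}M_i$ for each $i\geqslant1$; (3) for each $i\geqslant1$ and each component $T$ of $M_i$, the intersection $M_{i+1}\cap T$ is the union of solid tori which form a simple chain in $T$. *)

theory Defs
  imports "HOL-Analysis.Analysis" "HOL-Number_Theory.Cong"
begin

section \<open>Convex bodies, lines and projections\<close>

definition convex_body :: "(real^3) set \<Rightarrow> bool" where
  "convex_body K \<longleftrightarrow> compact K \<and> convex K \<and> interior K \<noteq> {}"

definition straight_line :: "(real^3) set \<Rightarrow> bool" where
  "straight_line l \<longleftrightarrow> affine l \<and> aff_dim l = 1"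

definition orth_proj :: "(real^3) set \<Rightarrow> real^3 \<Rightarrow> real^3" where
  "orth_proj l x = (THE y. y \<in> l \<and> (\<forall>z\<in>l. orthogonal (x - y) (z - y)))"


section \<open>Cantor sets\<close>

fun cantor_stage :: "nat \<Rightarrow> real set" where
  "cantor_stage 0 = {0..1}"
| "cantor_stage (Suc n) =
     (\<lambda>x. x / 3) ` cantor_stage n \<union> (\<lambda>x. 2 / 3 + x / 3) ` cantor_stage n"

definition middle_thirds_set :: "real set" where
  "middle_thirds_set = (\<Inter>n. cantor_stage n)"

definition cantor_set :: "(real^3) set \<Rightarrow> bool" where
  "cantor_set A \<longleftrightarrow> A homeomorphic middle_thirds_set"


section \<open>Round circles and linking\<close>

text \<open>The circle with center \<open>c\<close>, for perpendicular radius vectors \<open>u\<close>, \<open>v\<close>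
  (see \<open>radius_frame\<close>), traversed once at constant speed for \<open>t\<close> in \<open>[0,1]\<close>.\<close>

definition circle_loop :: "real^3 \<Rightarrow> real^3 \<Rightarrow> real^3 \<Rightarrow> real \<Rightarrow> real^3" where
  "circle_loop c u v t = c + cos (2 * pi * t) *\<^sub>R u + sin (2 * pi * t) *\<^sub>R v"

definition radius_frame :: "real^3 \<Rightarrow> real^3 \<Rightarrow> bool" where
  "radius_frame u v \<longleftrightarrow> u \<noteq> 0 \<and> norm u = norm v \<and> orthogonal u v"

text \<open>The center of a round circle is unique, so the choice is immaterial.\<close>

definition circle_center :: "(real^3) set \<Rightarrow> real^3" where
  "circle_center C = (SOME c. \<exists>u v. radius_frame u v \<and> C = path_image (circle_loop c u v))"

text \<open>The linking number of two disjoint smooth loops, as the Gauss linking integral.\<close>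

definition linking_number :: "(real \<Rightarrow> real^3) \<Rightarrow> (real \<Rightarrow> real^3) \<Rightarrow> real" where
  "linking_number \<gamma> \<delta> = 1 / (4 * pi) *
     integral {0..1} (\<lambda>s. integral {0..1} (\<lambda>t.
       ((\<gamma> s - \<delta> t) \<bullet> cross3 (vector_derivative \<gamma> (at s within {0..1}))
                               (vector_derivative \<delta> (at t within {0..1})))
       / norm (\<gamma> s - \<delta> t) ^ 3))"

text \<open>Changing the parametrizations of the circles (including their orientations) changes
  at most the sign of the linking number, so it does not matter which ones are used.\<close>

definition linked_circles :: "(real^3) set \<Rightarrow> (real^3) set \<Rightarrow> bool" where
  "linked_circles C C' \<longleftrightarrow>
     (\<exists>c u v c' u' v'. radius_frame u v \<and> C = path_image (circle_loop c u v) \<and>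
        radius_frame u' v' \<and> C' = path_image (circle_loop c' u' v') \<and>
        \<bar>linking_number (circle_loop c u v) (circle_loop c' u' v')\<bar> = 1)"


section \<open>Standard solid tori\<close>

text \<open>Rotations of space about the line \<open>l\<close>: orientation-preserving isometries fixing
  \<open>l\<close> pointwise.\<close>

definition rotation_about :: "(real^3) set \<Rightarrow> (real^3 \<Rightarrow> real^3) \<Rightarrow> bool" where
  "rotation_about l f \<longleftrightarrow>
     (\<exists>p g. orthogonal_transformation g \<and> det (matrix g) = 1 \<and> f = (\<lambda>x. p + g (x - p))) \<and>
     (\<forall>x\<in>l. f x = x)"

definition revolve :: "(real^3) set \<Rightarrow> (real^3) set \<Rightarrow> (real^3) set" where
  "revolve l S = (\<Union>f\<in>{f. rotation_about l f}. f ` S)"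

text \<open>\<open>T\<close> is generated by revolving about \<open>l\<close> the disk in \<open>P\<close> with center \<open>Q\<close> and
  radius \<open>r\<close>.\<close>

definition solid_torus_of ::
    "(real^3) set \<Rightarrow> (real^3) set \<Rightarrow> real^3 \<Rightarrow> real \<Rightarrow> (real^3) set \<Rightarrow> bool" where
  "solid_torus_of P l Q r T \<longleftrightarrow>
     affine P \<and> aff_dim P = 2 \<and> straight_line l \<and> l \<subseteq> P \<and> Q \<in> P \<and>
     0 < r \<and> r < infdist Q l \<and> T = revolve l (cball Q r \<inter> P)"

definition standard_solid_torus :: "(real^3) set \<Rightarrow> bool" where
  "standard_solid_torus T \<longleftrightarrow> (\<exists>P l Q r. solid_torus_of P l Q r T)"

text \<open>The central circle is determined by the set \<open>T\<close>, so the choice is immaterial.\<close>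

definition central_circle :: "(real^3) set \<Rightarrow> (real^3) set" where
  "central_circle T = (SOME C. \<exists>P l Q r. solid_torus_of P l Q r T \<and> C = revolve l {Q})"

definition torus_center :: "(real^3) set \<Rightarrow> real^3" where
  "torus_center T = circle_center (central_circle T)"

definition linked_tori :: "(real^3) set \<Rightarrow> (real^3) set \<Rightarrow> bool" where
  "linked_tori T T' \<longleftrightarrow> disjnt T T' \<and> linked_circles (central_circle T) (central_circle T')"


section \<open>Simple chains and Antoine's necklaces\<close>

definition congruent_sets :: "(real^3) set \<Rightarrow> (real^3) set \<Rightarrow> bool" where
  "congruent_sets S S' \<longleftrightarrow> (\<exists>f. (\<forall>x y. dist (f x) (f y) = dist x y) \<and> f ` S = S')"

text \<open>The tori of the chain are \<open>\<tau> 0, \<dots>, \<tau> (q - 1)\<close>.  The points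
  \<open>circle_loop c u v (i / q)\<close>, \<open>i < q\<close>, are the subsequent vertices of a regular convex
  \<open>q\<close>-gon inscribed in the circle; every such polygon, with every starting vertex and both
  orientations, arises from some \<open>u\<close>, \<open>v\<close>.\<close>

definition simple_chain :: "(real^3) set \<Rightarrow> nat \<Rightarrow> (nat \<Rightarrow> (real^3) set) \<Rightarrow> bool" where
  "simple_chain T q \<tau> \<longleftrightarrow>
     standard_solid_torus T \<and> q \<ge> 3 \<and>
     (\<forall>i<q. standard_solid_torus (\<tau> i)) \<and>
     (\<forall>i<q. \<forall>j<q. i \<noteq> j \<longrightarrow> disjnt (\<tau> i) (\<tau> j)) \<and>
     (\<forall>i<q. \<forall>j<q. congruent_sets (\<tau> i) (\<tau> j)) \<and>
     (\<Union>i<q. \<tau> i) \<subseteq> interior T \<and>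
     (\<exists>c u v. radius_frame u v \<and> central_circle T = path_image (circle_loop c u v) \<and>
        (\<forall>i<q. torus_center (\<tau> i) = circle_loop c u v (real i / real q))) \<and>
     (\<forall>i<q. \<forall>j<q. i \<noteq> j \<longrightarrow>
        (linked_tori (\<tau> i) (\<tau> j) \<longleftrightarrow>
           [int i - int j = 1] (mod int q) \<or> [int i - int j = -1] (mod int q))) \<and>
     (\<forall>i<q. \<exists>a. homotopic_with_canon (\<lambda>h. True) (central_circle (\<tau> i)) T (\<lambda>x. x) (\<lambda>x. a))"

definition antoine_necklace :: "(real^3) set \<Rightarrow> bool" where
  "antoine_necklace A \<longleftrightarrow> cantor_set A \<and>
     (\<exists>M :: nat \<Rightarrow> (real^3) set.
        A = (\<Inter>i\<in>{1..}. M i) \<and>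
        (\<forall>i\<ge>1. \<exists>F. finite F \<and> pairwise disjnt F \<and> (\<forall>T\<in>F. standard_solid_torus T) \<and>
           M i = \<Union>F) \<and>
        standard_solid_torus (M 1) \<and>
        (\<forall>i\<ge>1. M (i + 1) \<subseteq> interior (M i)) \<and>
        (\<forall>i\<ge>1. \<forall>T\<in>components (M i). \<exists>q \<tau>.
           simple_chain T q \<tau> \<and> M (i + 1) \<inter> T = (\<Union>j<q. \<tau> j)))"

end

(* The body K is the convex hull of A, so the claim is that every linear functional maps A onto an
   interval and is not constant on A.

   If two disjoint round circles have Gauss linking number 1 or -1, each meets the disk of the
   other: otherwise one of them can be shrunk inside its disk away from the other one. A circle
   centered on the central circle of a solid torus T and null-homotopic in T has radius at most
   the radius r of the tube, so the centers of consecutive links of a simple chain in T are at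
   distance at most 2r, and the regular polygon of these centers contains all points of the disk
   of T at distance at least r from its boundary. Two linked disjoint tori have such a deep point in
   common. By induction on the stages, a deep point of a torus T of some stage lies in the convex
   hull of the part of any later stage in T; hence the parts of a later stage in consecutive links
   have images that overlap, and the image of each stage in T is an interval. A functional that is
   constant on A would be constant on two linked circles, whose linking number would vanish. *)
theory Submission
  imports Defs "HOL-Complex_Analysis.Winding_Numbers"
begin

section \<open>The Gauss linking integral\<close>

text \<open>What has to survive from stage to stage is a set of points lying in the hull of every
  later part of a torus \<open>T\<close>. The whole disk of \<open>T\<close> is too large for this,
  because the polygon of the link centers misses points near the circle; the center alone is too
  small, because linked tori need not share it. The depth \<open>r\<close> suits both purposes. If
  the sides of the polygon have length at most \<open>2 * r\<close> and \<open>h\<close> is half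
  their central angle, then \<open>R * sin h \<le> r\<close> and
  \<open>1 - cos h \<le> sin h\<close> make the apothem \<open>R * cos h\<close> at least
  \<open>R - r\<close>. Conversely, disjoint tubes have circles more than \<open>r + r'\<close>
  apart, which is just enough room for a common point of depth \<open>r\<close> in one disk and
  \<open>r'\<close> in the other. Such a point lies in the hulls of two consecutive parts, not in
  the parts themselves; its value is attained on both of them because their images are already known
  to be convex.\<close>

lemma triple_derivative:
  fixes r p q :: "real \<Rightarrow> real^3"
  assumes r: "(r has_vector_derivative r') (at x within S)"
    and p: "(p has_vector_derivative p') (at x within S)"
    and q: "(q has_vector_derivative q') (at x within S)"
    and nz: "r x \<noteq> 0"
  shows "((\<lambda>x. (r x \<bullet> cross3 (p x) (q x)) / norm (r x) ^ 3) has_vector_derivative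
           (r' \<bullet> cross3 (p x) (q x) + r x \<bullet> cross3 p' (q x) + r x \<bullet> cross3 (p x) q') / norm (r x) ^ 3
           - 3 * (r x \<bullet> r') * (r x \<bullet> cross3 (p x) (q x)) / norm (r x) ^ 5) (at x within S)"
proof -
  have bb: "bounded_bilinear (cross3)"
    using bilinear_cross bilinear_conv_bounded_bilinear by blast
  have c: "((\<lambda>x. cross3 (p x) (q x)) has_vector_derivative cross3 (p x) q' + cross3 p' (q x)) (at x within S)"
    by (rule bounded_bilinear.has_vector_derivative[OF bb p q])
  have num: "((\<lambda>x. r x \<bullet> cross3 (p x) (q x)) has_real_derivative
      r x \<bullet> (cross3 (p x) q' + cross3 p' (q x)) + r' \<bullet> cross3 (p x) (q x)) (at x within S)"
    using bounded_bilinear.has_vector_derivative[OF bounded_bilinear_inner r c]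
    by (simp add: has_real_derivative_iff_has_vector_derivative)
  have sq: "((\<lambda>x. r x \<bullet> r x) has_real_derivative 2 * (r x \<bullet> r')) (at x within S)"
    using bounded_bilinear.has_vector_derivative[OF bounded_bilinear_inner r r]
    by (simp add: has_real_derivative_iff_has_vector_derivative inner_commute)
  have pos: "r x \<bullet> r x > 0" using nz by simp
  have nrm: "((\<lambda>x. norm (r x)) has_real_derivative (r x \<bullet> r') / norm (r x)) (at x within S)"
    using DERIV_chain2[OF DERIV_real_sqrt[OF pos] sq]
    by (simp add: norm_eq_sqrt_inner field_simps)
  have den: "((\<lambda>x. norm (r x) ^ 3) has_real_derivative 3 * norm (r x) * (r x \<bullet> r')) (at x within S)"
    by (rule derivative_eq_intros nrm | simp)+ (use nz in \<open>simp add: field_simps power2_eq_square\<close>)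
  have "((\<lambda>x. (r x \<bullet> cross3 (p x) (q x)) / norm (r x) ^ 3) has_real_derivative
     ((r x \<bullet> (cross3 (p x) q' + cross3 p' (q x)) + r' \<bullet> cross3 (p x) (q x)) * norm (r x) ^ 3
       - (r x \<bullet> cross3 (p x) (q x)) * (3 * norm (r x) * (r x \<bullet> r'))) / (norm (r x) ^ 3 * norm (r x) ^ 3))
       (at x within S)"
    by (rule DERIV_divide[OF num den]) (use nz in simp)
  moreover have "((r x \<bullet> (cross3 (p x) q' + cross3 p' (q x)) + r' \<bullet> cross3 (p x) (q x)) * norm (r x) ^ 3
       - (r x \<bullet> cross3 (p x) (q x)) * (3 * norm (r x) * (r x \<bullet> r'))) / (norm (r x) ^ 3 * norm (r x) ^ 3)
     = (r' \<bullet> cross3 (p x) (q x) + r x \<bullet> cross3 p' (q x) + r x \<bullet> cross3 (p x) q') / norm (r x) ^ 3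
           - 3 * (r x \<bullet> r') * (r x \<bullet> cross3 (p x) (q x)) / norm (r x) ^ 5"
    using nz by (simp add: divide_simps inner_add_right) (simp add: algebra_simps eval_nat_numeral)
  ultimately show ?thesis by (simp add: has_real_derivative_iff_has_vector_derivative)
qed

text \<open>Cramer's rule writes \<open>(a \<bullet> cross3 b d) *\<^sub>R r\<close> as a
  combination of \<open>a\<close>, \<open>b\<close>, \<open>d\<close> with triple products as
  coefficients; this is that expansion paired with \<open>r\<close>. It makes the Gauss form closed,
  and when the scalar products with \<open>r\<close> vanish it serves as a dimension argument in
  3-space.\<close>

lemma triple_identity:
  fixes r a b d :: "real^3"
  shows "(r \<bullet> a) * (r \<bullet> cross3 b d) - (r \<bullet> b) * (r \<bullet> cross3 a d) + (r \<bullet> d) * (r \<bullet> cross3 a b)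
     = (r \<bullet> r) * (a \<bullet> cross3 b d)"
  by (simp add: cross3_def inner_vec_def sum_3 vector_3) algebra

text \<open>In its application \<open>N\<close> is the norm of \<open>r\<close>, the numbers
  \<open>p\<close>, \<open>a\<close>, \<open>q\<close> are the scalar products of \<open>r\<close>
  with \<open>e\<close>, \<open>l *\<^sub>R e'\<close>, \<open>d'\<close>, and \<open>Q\<close>,
  \<open>X\<close>, \<open>Y\<close> are the complementary triple products. The left side is then
  the \<open>l\<close>-derivative of the Gauss integrand and the right side the divergence.\<close>

lemma closed_form_arith:
  fixes N :: real
  assumes "N \<noteq> 0" and "p * Q - a * X + q * Y = N ^ 2 * A"
  shows "(A + B) / N ^ 3 - 3 * p * Q / N ^ 5
     = ((- A + B) / N ^ 3 - 3 * a * X / N ^ 5) + (- A / N ^ 3 + 3 * q * Y / N ^ 5)"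
proof -
  have "3 * p * Q = 3 * (N ^ 2 * A) + 3 * a * X - 3 * q * Y" using assms(2) by simp
  moreover have "3 * (N ^ 2 * A) / N ^ 5 = 3 * A / N ^ 3"
    using assms(1) by (simp add: field_simps eval_nat_numeral)
  ultimately have "3 * p * Q / N ^ 5 = 3 * A / N ^ 3 + 3 * a * X / N ^ 5 - 3 * q * Y / N ^ 5"
    by (simp add: add_divide_distrib diff_divide_distrib)
  then show ?thesis by (simp add: add_divide_distrib diff_divide_distrib)
qed

lemma integral_swap_unit_square:
  fixes f :: "real \<Rightarrow> real \<Rightarrow> real"
  assumes "continuous_on ({0..1} \<times> {0..1}) (\<lambda>(x, y). f x y)"
  shows "integral {0..1} (\<lambda>x. integral {0..1} (f x)) = integral {0..1} (\<lambda>y. integral {0..1} (\<lambda>x. f x y))"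
  using integral_swap_continuous[of 0 0 1 1 f] assms
  by (simp add: cbox_Pair_eq)

lemma integral_continuous_unit:
  fixes f :: "'a::topological_space \<Rightarrow> real \<Rightarrow> real"
  assumes "continuous_on (U \<times> {0..1}) (\<lambda>(x, y). f x y)"
  shows "continuous_on U (\<lambda>x. integral {0..1} (f x))"
  using integral_continuous_on_param[of U 0 1 f] assms by simp

text \<open>If the derivative of a double integrand in a parameter \<open>l\<close> is a divergence
  \<open>dX/ds + dY/dt\<close> with \<open>X\<close>, \<open>Y\<close> periodic, then the double integral does not depend on \<open>l\<close>.\<close>

lemma integral_transport:
  fixes F X Y F' X' Y' :: "real \<Rightarrow> real \<Rightarrow> real \<Rightarrow> real"
  assumes F: "\<And>l s t. l \<in> {0..1} \<Longrightarrow> s \<in> {0..1} \<Longrightarrow> t \<in> {0..1} \<Longrightarrow>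
      ((\<lambda>l. F l s t) has_vector_derivative X' l s t + Y' l s t) (at l within {0..1})"
    and X: "\<And>l s t. l \<in> {0..1} \<Longrightarrow> s \<in> {0..1} \<Longrightarrow> t \<in> {0..1} \<Longrightarrow>
      ((\<lambda>s. X l s t) has_vector_derivative X' l s t) (at s within {0..1})"
    and Y: "\<And>l s t. l \<in> {0..1} \<Longrightarrow> s \<in> {0..1} \<Longrightarrow> t \<in> {0..1} \<Longrightarrow>
      ((\<lambda>t. Y l s t) has_vector_derivative Y' l s t) (at t within {0..1})"
    and pX: "\<And>l t. X l 1 t = X l 0 t" and pY: "\<And>l s. Y l s 1 = Y l s 0"
    and cX: "continuous_on ({0..1} \<times> {0..1} \<times> {0..1}) (\<lambda>(l, s, t). X' l s t)"
    and cY: "continuous_on ({0..1} \<times> {0..1} \<times> {0..1}) (\<lambda>(l, s, t). Y' l s t)"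
  shows "integral {0..1} (\<lambda>s. integral {0..1} (\<lambda>t. F 1 s t - F 0 s t)) = 0"
proof -
  let ?I = "{0..1::real}"
  have swap: "(\<lambda>x. (snd x, fst x)) ` ((?I \<times> ?I) \<times> ?I) \<subseteq> ?I \<times> ?I \<times> ?I" by auto
  have cswap: "continuous_on ((?I \<times> ?I) \<times> ?I) (\<lambda>x. (snd x, fst x))" by (intro continuous_intros)
  have cX1: "continuous_on ((?I \<times> ?I) \<times> ?I) (\<lambda>(p, l). X' l (fst p) (snd p))"
    using continuous_on_compose2[OF cX cswap swap] by (simp add: case_prod_beta)
  have cY1: "continuous_on ((?I \<times> ?I) \<times> ?I) (\<lambda>(p, l). Y' l (fst p) (snd p))"
    using continuous_on_compose2[OF cY cswap swap] by (simp add: case_prod_beta)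
  \<comment> \<open>By the fundamental theorem in \<open>l\<close>, the increment of
    \<open>F\<close> is \<open>J + K\<close>; each term vanishes once it is integrated over its own
    periodic variable, \<open>s\<close> for \<open>J\<close> and \<open>t\<close> for
    \<open>K\<close>.\<close>
  define J where "J s t = integral ?I (\<lambda>l. X' l s t)" for s t
  define K where "K s t = integral ?I (\<lambda>l. Y' l s t)" for s t
  have cJ: "continuous_on (?I \<times> ?I) (\<lambda>(s,t). J s t)"
    using integral_continuous_unit[OF cX1] by (simp add: J_def case_prod_beta)
  have cK: "continuous_on (?I \<times> ?I) (\<lambda>(s,t). K s t)"
    using integral_continuous_unit[OF cY1] by (simp add: K_def case_prod_beta)
  have slice: "continuous_on ?I (\<lambda>l. g l s t)"
    if "continuous_on (?I \<times> ?I \<times> ?I) (\<lambda>(l, s, t). g l s t)" "s \<in> ?I" "t \<in> ?I" for g :: "real \<Rightarrow> real \<Rightarrow> real \<Rightarrow> real" and s t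
  proof -
    have "continuous_on ?I (\<lambda>l. case (l, s, t) of (l, s, t) \<Rightarrow> g l s t)"
      by (rule continuous_on_compose2[OF that(1)]) (use that in \<open>auto intro!: continuous_intros\<close>)
    then show ?thesis by simp
  qed
  have slice1: "continuous_on ?I (\<lambda>t. g s t)" if "continuous_on (?I \<times> ?I) (\<lambda>(s, t). g s t)" "s \<in> ?I"
    for g :: "real \<Rightarrow> real \<Rightarrow> real" and s
  proof -
    have "continuous_on ?I (\<lambda>t. case (s, t) of (s, t) \<Rightarrow> g s t)"
      by (rule continuous_on_compose2[OF that(1)]) (use that in \<open>auto intro!: continuous_intros\<close>)
    then show ?thesis by simp
  qed
  have FJK: "F 1 s t - F 0 s t = J s t + K s t" if "s \<in> ?I" "t \<in> ?I" for s t
  proof -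
    have "((\<lambda>l. X' l s t + Y' l s t) has_integral F 1 s t - F 0 s t) ?I"
      by (rule fundamental_theorem_of_calculus) (use F that in auto)
    moreover have "integral ?I (\<lambda>l. X' l s t + Y' l s t) = J s t + K s t"
      unfolding J_def K_def
      by (rule integral_add) (auto intro!: integrable_continuous_interval slice cX cY that)
    ultimately show ?thesis by (simp add: integral_unique)
  qed
  have K0: "integral ?I (\<lambda>t. K s t) = 0" if s: "s \<in> ?I" for s
  proof -
    have "continuous_on (?I \<times> ?I) (\<lambda>p. case (snd p, s, fst p) of (l, s, t) \<Rightarrow> Y' l s t)"
      by (rule continuous_on_compose2[OF cY]) (use s in \<open>auto intro!: continuous_intros\<close>)
    then have "continuous_on (?I \<times> ?I) (\<lambda>(t, l). Y' l s t)" by (simp add: case_prod_beta)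
    then have "integral ?I (\<lambda>t. K s t) = integral ?I (\<lambda>l. integral ?I (\<lambda>t. Y' l s t))"
      unfolding K_def by (rule integral_swap_unit_square)
    also have "\<dots> = integral ?I (\<lambda>l. 0)"
    proof (rule Henstock_Kurzweil_Integration.integral_cong)
      fix l :: real assume "l \<in> ?I"
      then have "((\<lambda>t. Y' l s t) has_integral Y l s 1 - Y l s 0) ?I"
        by (intro fundamental_theorem_of_calculus) (use Y s in auto)
      then show "integral ?I (\<lambda>t. Y' l s t) = 0" by (simp add: pY integral_unique)
    qed
    finally show ?thesis by simp
  qed
  have J0: "integral ?I (\<lambda>s. J s t) = 0" if t: "t \<in> ?I" for t
  proof -
    have "continuous_on (?I \<times> ?I) (\<lambda>p. case (snd p, fst p, t) of (l, s, t) \<Rightarrow> X' l s t)"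
      by (rule continuous_on_compose2[OF cX]) (use t in \<open>auto intro!: continuous_intros\<close>)
    then have "continuous_on (?I \<times> ?I) (\<lambda>(s, l). X' l s t)" by (simp add: case_prod_beta)
    then have "integral ?I (\<lambda>s. J s t) = integral ?I (\<lambda>l. integral ?I (\<lambda>s. X' l s t))"
      unfolding J_def by (rule integral_swap_unit_square)
    also have "\<dots> = integral ?I (\<lambda>l. 0)"
    proof (rule Henstock_Kurzweil_Integration.integral_cong)
      fix l :: real assume "l \<in> ?I"
      then have "((\<lambda>s. X' l s t) has_integral X l 1 t - X l 0 t) ?I"
        by (intro fundamental_theorem_of_calculus) (use X t in auto)
      then show "integral ?I (\<lambda>s. X' l s t) = 0" by (simp add: pX integral_unique)
    qed
    finally show ?thesis by simp
  qed
  have "integral ?I (\<lambda>s. integral ?I (\<lambda>t. F 1 s t - F 0 s t)) = integral ?I (\<lambda>s. integral ?I (\<lambda>t. J s t))"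
  proof (rule Henstock_Kurzweil_Integration.integral_cong)
    fix s :: real assume s: "s \<in> ?I"
    have "integral ?I (\<lambda>t. F 1 s t - F 0 s t) = integral ?I (\<lambda>t. J s t + K s t)"
      by (rule Henstock_Kurzweil_Integration.integral_cong) (use FJK s in auto)
    also have "\<dots> = integral ?I (\<lambda>t. J s t) + integral ?I (\<lambda>t. K s t)"
      by (rule integral_add) (auto intro!: integrable_continuous_interval slice1[OF cJ] slice1[OF cK] s)
    finally show "integral ?I (\<lambda>t. F 1 s t - F 0 s t) = integral ?I (\<lambda>t. J s t)" using K0[OF s] by simp
  qed
  also have "\<dots> = integral ?I (\<lambda>t. integral ?I (\<lambda>s. J s t))"
    by (rule integral_swap_unit_square[OF cJ])
  also have "\<dots> = integral ?I (\<lambda>t. 0)"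
    by (rule Henstock_Kurzweil_Integration.integral_cong) (use J0 in auto)
  finally show ?thesis by simp
qed

text \<open>Shrink the first circle to its center inside its disk. The Gauss integrand is the pullback of
  the closed 2-form \<open>det(r, \<cdot>, \<cdot>) / |r|^3\<close> under \<open>r = c + l e(s) - d(t)\<close>, so its derivative in \<open>l\<close>
  is a divergence; the linking number is therefore constant in \<open>l\<close>, and it vanishes for \<open>l = 0\<close>.\<close>

lemma linking_number_shrink:
  assumes "path_image (circle_loop c' u' v') \<inter> convex hull path_image (circle_loop c u v) = {}"
  shows "linking_number (circle_loop c u v) (circle_loop c' u' v') = 0"
proof -
  define e where "e s = cos (2 * pi * s) *\<^sub>R u + sin (2 * pi * s) *\<^sub>R v" for s
  define e' where "e' s = (2 * pi) *\<^sub>R (cos (2 * pi * s) *\<^sub>R v - sin (2 * pi * s) *\<^sub>R u)" for s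
  define d where "d = circle_loop c' u' v'"
  define d' where "d' t = (2 * pi) *\<^sub>R (cos (2 * pi * t) *\<^sub>R v' - sin (2 * pi * t) *\<^sub>R u')" for t
  define r where "r l s t = c + l *\<^sub>R e s - d t" for l s t
  have de: "(e has_vector_derivative e' s) (at s within S)" for s S
    unfolding e_def e'_def by (auto intro!: derivative_eq_intros simp: algebra_simps)
  have dd: "(d has_vector_derivative d' s) (at s within S)" for s S
    unfolding d_def d'_def circle_loop_def by (auto intro!: derivative_eq_intros simp: algebra_simps)
  have c_in: "c \<in> convex hull path_image (circle_loop c u v)"
  proof -
    have "circle_loop c u v 0 \<in> path_image (circle_loop c u v)"
      "circle_loop c u v (1/2) \<in> path_image (circle_loop c u v)"
      by (auto simp: path_image_def)
    then have "(1/2) *\<^sub>R circle_loop c u v 0 + (1/2) *\<^sub>R circle_loop c u v (1/2) \<in> convex hull path_image (circle_loop c u v)"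
      by (intro convexD[OF convex_convex_hull]) (auto intro: hull_inc)
    then show ?thesis by (simp add: circle_loop_def algebra_simps flip: scaleR_add_left)
  qed
  \<comment> \<open>A zero would be a point of the second circle on a radius of the first one, hence
    in its disk.\<close>
  have nz: "r l s t \<noteq> 0" if "l \<in> {0..1}" "s \<in> {0..1}" "t \<in> {0..1}" for l s t
  proof
    assume "r l s t = 0"
    then have eq: "d t = (1 - l) *\<^sub>R c + l *\<^sub>R circle_loop c u v s"
      by (simp add: r_def e_def circle_loop_def algebra_simps)
    have "circle_loop c u v s \<in> convex hull path_image (circle_loop c u v)"
      using that by (intro hull_inc) (auto simp: path_image_def)
    then have "d t \<in> convex hull path_image (circle_loop c u v)"
      unfolding eq using that c_in by (intro convexD[OF convex_convex_hull]) auto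
    moreover have "d t \<in> path_image (circle_loop c' u' v')"
      using that by (auto simp: path_image_def d_def)
    ultimately show False using assms by blast
  qed
  \<comment> \<open>Cartan's formula: \<open>X\<close> and \<open>Y\<close> are the closed form
    contracted with the velocity \<open>e s\<close> in \<open>l\<close> and one tangent vector.
    Since the \<open>t\<close>-derivative of \<open>r\<close> is \<open>- d' t\<close>, the usual
    difference of partial derivatives becomes a sum.\<close>
  define F where "F l s t = r l s t \<bullet> cross3 (l *\<^sub>R e' s) (d' t) / norm (r l s t) ^ 3" for l s t
  define X where "X l s t = r l s t \<bullet> cross3 (e s) (d' t) / norm (r l s t) ^ 3" for l s t
  define Y where "Y l s t = r l s t \<bullet> cross3 (e s) (l *\<^sub>R e' s) / norm (r l s t) ^ 3" for l s t
  define X' where "X' l s t = ((l *\<^sub>R e' s) \<bullet> cross3 (e s) (d' t) + r l s t \<bullet> cross3 (e' s) (d' t)) / norm (r l s t) ^ 3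
     - 3 * (r l s t \<bullet> (l *\<^sub>R e' s)) * (r l s t \<bullet> cross3 (e s) (d' t)) / norm (r l s t) ^ 5" for l s t
  define Y' where "Y' l s t = (- d' t \<bullet> cross3 (e s) (l *\<^sub>R e' s)) / norm (r l s t) ^ 3
     + 3 * (r l s t \<bullet> d' t) * (r l s t \<bullet> cross3 (e s) (l *\<^sub>R e' s)) / norm (r l s t) ^ 5" for l s t
  note crs = cross_add_left cross_add_right cross_mult_left cross_mult_right cross_minus_left cross_minus_right
  have rl: "((\<lambda>l. r l s t) has_vector_derivative e s) (at l within S)" for l s t S
    unfolding r_def by (auto intro!: derivative_eq_intros)
  have rs: "((\<lambda>s. r l s t) has_vector_derivative l *\<^sub>R e' s) (at s within S)" for l s t S
    unfolding r_def by (auto intro!: derivative_eq_intros de)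
  have rt: "((\<lambda>t. r l s t) has_vector_derivative - d' t) (at t within S)" for l s t S
    unfolding r_def by (auto intro!: derivative_eq_intros dd)
  have main: "integral {0..1} (\<lambda>s. integral {0..1} (\<lambda>t. F 1 s t - F 0 s t)) = 0"
  proof (rule integral_transport[of F X' Y' X Y])
    fix l s t :: real assume i: "l \<in> {0..1}" "s \<in> {0..1}" "t \<in> {0..1}"
    have "((\<lambda>l. F l s t) has_vector_derivative
       (e s \<bullet> cross3 (l *\<^sub>R e' s) (d' t) + r l s t \<bullet> cross3 (e' s) (d' t) + r l s t \<bullet> cross3 (l *\<^sub>R e' s) 0) / norm (r l s t) ^ 3
           - 3 * (r l s t \<bullet> e s) * (r l s t \<bullet> cross3 (l *\<^sub>R e' s) (d' t)) / norm (r l s t) ^ 5) (at l within {0..1})"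
      unfolding F_def by (rule triple_derivative[OF rl _ _ nz[OF i]]) (auto intro!: derivative_eq_intros)
    moreover have "(e s \<bullet> cross3 (l *\<^sub>R e' s) (d' t) + r l s t \<bullet> cross3 (e' s) (d' t) + r l s t \<bullet> cross3 (l *\<^sub>R e' s) 0) / norm (r l s t) ^ 3
           - 3 * (r l s t \<bullet> e s) * (r l s t \<bullet> cross3 (l *\<^sub>R e' s) (d' t)) / norm (r l s t) ^ 5 = X' l s t + Y' l s t"
    proof -
      let ?r = "r l s t" and ?N = "norm (r l s t)"
      have N: "?N \<noteq> 0" using nz i by simp
      have id: "(?r \<bullet> e s) * (?r \<bullet> cross3 (l *\<^sub>R e' s) (d' t)) - (?r \<bullet> (l *\<^sub>R e' s)) * (?r \<bullet> cross3 (e s) (d' t))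
          + (?r \<bullet> d' t) * (?r \<bullet> cross3 (e s) (l *\<^sub>R e' s)) = ?N ^ 2 * (e s \<bullet> cross3 (l *\<^sub>R e' s) (d' t))"
        unfolding power2_norm_eq_inner by (rule triple_identity)
      have t1: "(l *\<^sub>R e' s) \<bullet> cross3 (e s) (d' t) = - (e s \<bullet> cross3 (l *\<^sub>R e' s) (d' t))"
        by (metis cross_skew cross_triple inner_commute inner_minus_left)
      have t2: "- d' t \<bullet> cross3 (e s) (l *\<^sub>R e' s) = - (e s \<bullet> cross3 (l *\<^sub>R e' s) (d' t))"
        by (metis cross_triple inner_commute inner_minus_left)
      show ?thesis
        unfolding X'_def Y'_def t1 t2 using closed_form_arith[OF N id] by simp
    qed
    ultimately show "((\<lambda>l. F l s t) has_vector_derivative X' l s t + Y' l s t) (at l within {0..1})" by simp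
    show "((\<lambda>s. X l s t) has_vector_derivative X' l s t) (at s within {0..1})"
      unfolding X_def X'_def
      by (rule has_vector_derivative_eq_rhs, rule triple_derivative[OF rs de has_vector_derivative_const])
         (auto simp: nz[OF i])
    show "((\<lambda>t. Y l s t) has_vector_derivative Y' l s t) (at t within {0..1})"
      unfolding Y_def Y'_def
      by (rule has_vector_derivative_eq_rhs, rule triple_derivative[OF rt has_vector_derivative_const has_vector_derivative_const])
         (auto simp: nz[OF i])
  next
    show "X l 1 t = X l 0 t" for l t by (simp add: X_def r_def e_def)
    show "Y l s 1 = Y l s 0" for l s by (simp add: Y_def r_def d_def circle_loop_def)
    have ce: "continuous_on S (\<lambda>x. e (f x))" "continuous_on S (\<lambda>x. e' (f x))"
      "continuous_on S (\<lambda>x. d (f x))" "continuous_on S (\<lambda>x. d' (f x))"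
      if "continuous_on S f" for S and f :: "real \<times> real \<times> real \<Rightarrow> real"
      unfolding e_def e'_def d_def d'_def circle_loop_def by (intro continuous_intros that)+
    show "continuous_on ({0..1} \<times> {0..1} \<times> {0..1}) (\<lambda>(l, s, t). X' l s t)"
      unfolding X'_def case_prod_beta
      by (intro continuous_intros continuous_on_cross ce) (use nz in \<open>auto simp: r_def intro!: continuous_intros ce\<close>)
    show "continuous_on ({0..1} \<times> {0..1} \<times> {0..1}) (\<lambda>(l, s, t). Y' l s t)"
      unfolding Y'_def case_prod_beta
      by (intro continuous_intros continuous_on_cross ce) (use nz in \<open>auto simp: r_def intro!: continuous_intros ce\<close>)
  qed
  have vd: "vector_derivative (circle_loop c u v) (at s within {0..1}) = e' s" if "s \<in> {0..1}" for s
  proof (rule vector_derivative_within_closed_interval)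
    have "circle_loop c u v = (\<lambda>s. c + e s)" by (auto simp: circle_loop_def e_def)
    then show "(circle_loop c u v has_vector_derivative e' s) (at s within {0..1})"
      by (auto intro!: derivative_eq_intros de)
  qed (use that in auto)
  have vd': "vector_derivative d (at s within {0..1}) = d' s" if "s \<in> {0..1}" for s
    by (rule vector_derivative_within_closed_interval[OF _ _ dd]) (use that in auto)
  \<comment> \<open>\<open>F 0\<close> is zero because of the factor \<open>l\<close>, so
    subtracting it leaves the Gauss integrand unchanged.\<close>
  have "integral {0..1} (\<lambda>s. integral {0..1} (\<lambda>t.
       ((circle_loop c u v s - d t) \<bullet> cross3 (vector_derivative (circle_loop c u v) (at s within {0..1}))
                               (vector_derivative d (at t within {0..1})))
       / norm (circle_loop c u v s - d t) ^ 3)) = integral {0..1} (\<lambda>s. integral {0..1} (\<lambda>t. F 1 s t - F 0 s t))"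
    by (intro Henstock_Kurzweil_Integration.integral_cong)
       (simp add: vd vd' F_def r_def e_def circle_loop_def algebra_simps)
  with main show ?thesis by (simp add: linking_number_def d_def)
qed

section \<open>Round circles\<close>

text \<open>With all real angles allowed, shifting an angle, as for antipodes or turned frames,
  needs no reduction modulo \<open>2 * pi\<close>.\<close>

lemma path_image_circle_loop:
  "path_image (circle_loop c u v) = range (\<lambda>a. c + cos a *\<^sub>R u + sin a *\<^sub>R v)"
proof (intro equalityI subsetI)
  fix x assume "x \<in> range (\<lambda>a. c + cos a *\<^sub>R u + sin a *\<^sub>R v)"
  then obtain a where x: "x = c + cos a *\<^sub>R u + sin a *\<^sub>R v" by blast
  obtain t where "0 \<le> t" "t < 2 * pi" "cos a = cos t" "sin a = sin t"
    using sincos_total_2pi[of "cos a" "sin a"] by (auto simp: )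
  then have "x = circle_loop c u v (t / (2 * pi))" "t / (2 * pi) \<in> {0..1}"
    by (auto simp: x circle_loop_def)
  then show "x \<in> path_image (circle_loop c u v)" unfolding path_image_def by blast
qed (auto simp: path_image_def circle_loop_def)

lemma circle_loop_in_path_image: "circle_loop c u v t \<in> path_image (circle_loop c u v)"
  unfolding path_image_circle_loop by (auto simp: circle_loop_def)

lemma vector_derivative_circle_loop:
  assumes "t \<in> {0..1}"
  shows "vector_derivative (circle_loop c u v) (at t within {0..1})
     = (2 * pi) *\<^sub>R (cos (2 * pi * t) *\<^sub>R v - sin (2 * pi * t) *\<^sub>R u)"
proof (rule vector_derivative_within_closed_interval)
  show "(circle_loop c u v has_vector_derivative
      (2 * pi) *\<^sub>R (cos (2 * pi * t) *\<^sub>R v - sin (2 * pi * t) *\<^sub>R u)) (at t within {0..1})"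
    unfolding circle_loop_def by (auto intro!: derivative_eq_intros simp: algebra_simps)
qed (use assms in auto)

text \<open>Exchanging the loops reverses both the difference vector and the cross product, so the
  signs cancel and only the order of integration changes. Disjointness makes the integrand
  continuous for this swap.\<close>

lemma linking_number_circles_commute:
  assumes "path_image (circle_loop c u v) \<inter> path_image (circle_loop c' u' v') = {}"
  shows "linking_number (circle_loop c u v) (circle_loop c' u' v')
     = linking_number (circle_loop c' u' v') (circle_loop c u v)"
proof -
  let ?g = "circle_loop c u v" and ?d = "circle_loop c' u' v'"
  define g' where "g' t = (2 * pi) *\<^sub>R (cos (2 * pi * t) *\<^sub>R v - sin (2 * pi * t) *\<^sub>R u)" for t
  define d' where "d' t = (2 * pi) *\<^sub>R (cos (2 * pi * t) *\<^sub>R v' - sin (2 * pi * t) *\<^sub>R u')" for t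
  define f where "f s t = (?g s - ?d t) \<bullet> cross3 (g' s) (d' t) / norm (?g s - ?d t) ^ 3" for s t
  have ne: "?g s \<noteq> ?d t" for s t
    using assms circle_loop_in_path_image by (metis disjoint_iff)
  have cont: "continuous_on S (\<lambda>x. ?g (h x))" "continuous_on S (\<lambda>x. ?d (h x))"
    "continuous_on S (\<lambda>x. g' (h x))" "continuous_on S (\<lambda>x. d' (h x))"
    if "continuous_on S h" for S and h :: "real \<times> real \<Rightarrow> real"
    unfolding circle_loop_def g'_def d'_def by (intro continuous_intros that)+
  have "continuous_on ({0..1} \<times> {0..1}) (\<lambda>(s, t). f s t)"
    unfolding f_def case_prod_beta
    by (intro continuous_intros continuous_on_cross cont) (simp add: ne)
  then have "integral {0..1} (\<lambda>s. integral {0..1} (f s)) = integral {0..1} (\<lambda>t. integral {0..1} (\<lambda>s. f s t))"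
    by (rule integral_swap_unit_square)
  note swap = this
  have "(?d t - ?g s) \<bullet> cross3 (d' t) (g' s) / norm (?d t - ?g s) ^ 3 = f s t" for s t
  proof -
    have "cross3 (d' t) (g' s) = - cross3 (g' s) (d' t)" by (rule cross_skew)
    then show ?thesis
      by (simp add: f_def norm_minus_commute inner_diff_left)
  qed
  note sym = this
  have "linking_number ?g ?d = 1 / (4 * pi) * integral {0..1} (\<lambda>s. integral {0..1} (f s))"
    unfolding linking_number_def f_def g'_def d'_def
    by (intro arg_cong[where f = "(*) (1 / (4 * pi))"] Henstock_Kurzweil_Integration.integral_cong)
       (simp only: vector_derivative_circle_loop)
  moreover have "linking_number ?d ?g = 1 / (4 * pi) * integral {0..1} (\<lambda>t. integral {0..1} (\<lambda>s. f s t))"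
    unfolding linking_number_def sym[symmetric] g'_def d'_def
    by (intro arg_cong[where f = "(*) (1 / (4 * pi))"] Henstock_Kurzweil_Integration.integral_cong)
       (simp only: vector_derivative_circle_loop)
  ultimately show ?thesis using swap by simp
qed

lemma linked_circles_meet:
  assumes "linked_circles C C'"
  shows "C \<inter> convex hull C' \<noteq> {}" and "C' \<inter> convex hull C \<noteq> {}"
proof -
  obtain c u v c' u' v' where C: "C = path_image (circle_loop c u v)" "C' = path_image (circle_loop c' u' v')"
    and l: "\<bar>linking_number (circle_loop c u v) (circle_loop c' u' v')\<bar> = 1"
    using assms unfolding linked_circles_def by blast
  show "C' \<inter> convex hull C \<noteq> {}"
    using linking_number_shrink l C by fastforce
  show "C \<inter> convex hull C' \<noteq> {}"
  proof
    assume e: "C \<inter> convex hull C' = {}"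
    \<comment> \<open>The disjointness required for exchanging the circles comes from the assumption
      under refutation, since \<open>C'\<close> lies in its own hull.\<close>
    then have "C \<inter> C' = {}" using hull_subset[of C' convex] by blast
    then show False
      using linking_number_shrink[of c u v c' u' v'] linking_number_circles_commute[of c u v c' u' v'] e l C
      by simp
  qed
qed

text \<open>In a common plane the three vectors in the Gauss integrand are all orthogonal to
  \<open>a\<close>, so their triple product is zero everywhere.\<close>

lemma linked_circles_not_coplanar:
  assumes l: "linked_circles C C'" and a: "a \<noteq> 0" and const: "\<And>x. x \<in> C \<union> C' \<Longrightarrow> a \<bullet> x = b"
  shows False
proof -
  obtain c u v c' u' v' where C: "C = path_image (circle_loop c u v)" "C' = path_image (circle_loop c' u' v')"
    and l: "\<bar>linking_number (circle_loop c u v) (circle_loop c' u' v')\<bar> = 1"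
    using l unfolding linked_circles_def by blast
  have orth: "a \<bullet> u = 0 \<and> a \<bullet> v = 0" if "\<And>x. x \<in> path_image (circle_loop c u v) \<Longrightarrow> a \<bullet> x = b" for c u v
  proof -
    \<comment> \<open>These are the points \<open>c + u\<close>, \<open>c - u\<close> and
      \<open>c + v\<close>.\<close>
    have "a \<bullet> circle_loop c u v 0 = b" "a \<bullet> circle_loop c u v (1/2) = b" "a \<bullet> circle_loop c u v (1/4) = b"
      using that circle_loop_in_path_image by blast+
    then show ?thesis by (simp add: circle_loop_def inner_add_right inner_diff_right)
  qed
  have o1: "a \<bullet> u = 0 \<and> a \<bullet> v = 0" and o2: "a \<bullet> u' = 0 \<and> a \<bullet> v' = 0"
    using orth[of c u v] orth[of c' u' v'] const C by auto
  have triple0: "x \<bullet> cross3 y z = 0" if "a \<bullet> x = 0" "a \<bullet> y = 0" "a \<bullet> z = 0" for x y z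
    using triple_identity[of a x y z] that a by simp
  have zero: "(circle_loop c u v s - circle_loop c' u' v' t) \<bullet>
        cross3 (vector_derivative (circle_loop c u v) (at s within {0..1}))
          (vector_derivative (circle_loop c' u' v') (at t within {0..1})) /
        norm (circle_loop c u v s - circle_loop c' u' v' t) ^ 3 = 0"
    if s: "s \<in> {0..1}" and t: "t \<in> {0..1}" for s t
  proof -
    have "a \<bullet> circle_loop c u v s = b" "a \<bullet> circle_loop c' u' v' t = b"
      using const C circle_loop_in_path_image by blast+
    then show ?thesis
      unfolding vector_derivative_circle_loop[OF s] vector_derivative_circle_loop[OF t]
      using triple0 o1 o2 by (simp add: inner_diff_right)
  qed
  have "linking_number (circle_loop c u v) (circle_loop c' u' v') = 1 / (4 * pi) *
     integral {0..1::real} (\<lambda>s. integral {0..1::real} (\<lambda>t. 0))"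
    unfolding linking_number_def
    by (intro arg_cong[where f = "(*) (1 / (4 * pi))"] Henstock_Kurzweil_Integration.integral_cong zero)
  then show False using l by simp
qed

lemma norm_frame_combination:
  assumes "radius_frame u v"
  shows "norm (x *\<^sub>R u + y *\<^sub>R v) = norm u * sqrt (x\<^sup>2 + y\<^sup>2)"
proof -
  have "(norm (x *\<^sub>R u + y *\<^sub>R v))\<^sup>2 = (norm u)\<^sup>2 * (x\<^sup>2 + y\<^sup>2)"
    using assms unfolding radius_frame_def orthogonal_def
    by (subst norm_add_Pythagorean) (auto simp: orthogonal_def power_mult_distrib algebra_simps)
  then have "norm (x *\<^sub>R u + y *\<^sub>R v) = sqrt ((norm u)\<^sup>2 * (x\<^sup>2 + y\<^sup>2))"
    by (intro real_sqrt_unique[symmetric]) auto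
  then show ?thesis by (simp add: real_sqrt_mult)
qed

lemma circle_dist_center:
  assumes "radius_frame u v" "x \<in> path_image (circle_loop c u v)"
  shows "dist x c = norm u"
  using assms norm_frame_combination[OF assms(1)]
  by (auto simp: path_image_circle_loop dist_norm add.assoc)

lemma circle_antipodal:
  assumes "x \<in> path_image (circle_loop c u v)"
  shows "2 *\<^sub>R c - x \<in> path_image (circle_loop c u v)"
proof -
  obtain a where "x = c + cos a *\<^sub>R u + sin a *\<^sub>R v" using assms by (auto simp: path_image_circle_loop)
  then have "2 *\<^sub>R c - x = c + cos (a + pi) *\<^sub>R u + sin (a + pi) *\<^sub>R v"
    by (simp add: algebra_simps scaleR_2)
  then show ?thesis unfolding path_image_circle_loop by blast
qed

lemma circle_center_in_hull: "c \<in> convex hull path_image (circle_loop c u v)"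
proof -
  let ?C = "path_image (circle_loop c u v)"
  have "circle_loop c u v 0 \<in> ?C" by (rule circle_loop_in_path_image)
  then have "(1/2) *\<^sub>R circle_loop c u v 0 + (1/2) *\<^sub>R (2 *\<^sub>R c - circle_loop c u v 0) \<in> convex hull ?C"
    by (intro convexD[OF convex_convex_hull] hull_inc circle_antipodal) auto
  then show ?thesis by (simp add: algebra_simps)
qed

text \<open>Two antipodal points of the first circle have the same distance from \<open>c'\<close>,
  so the parallelogram law gives \<open>half\<close>; adding this to its mirror image leaves twice
  the squared distance of the centers equal to zero.\<close>

lemma circle_center_radius_unique:
  assumes f: "radius_frame u v" and f': "radius_frame u' v'"
    and eq: "path_image (circle_loop c u v) = path_image (circle_loop c' u' v')"
  shows "c = c'" and "norm u = norm u'"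
proof -
  have half: "(dist c c')\<^sup>2 + (norm u)\<^sup>2 = (norm u')\<^sup>2"
    if f: "radius_frame u v" and f': "radius_frame u' v'"
    and eq: "path_image (circle_loop c u v) = path_image (circle_loop c' u' v')" for c u v c' u' v'
  proof -
    define x where "x = circle_loop c u v 0"
    have x: "x \<in> path_image (circle_loop c u v)" "2 *\<^sub>R c - x \<in> path_image (circle_loop c u v)"
      unfolding x_def by (intro circle_antipodal circle_loop_in_path_image)+
    have "norm (x - c') = norm u'" "norm (2 *\<^sub>R c - x - c') = norm u'" "norm (x - c) = norm u"
      using circle_dist_center[OF f'] circle_dist_center[OF f] x eq by (auto simp: dist_norm)
    then have "(x - c') \<bullet> (x - c') = (norm u')\<^sup>2" "(2 *\<^sub>R c - x - c') \<bullet> (2 *\<^sub>R c - x - c') = (norm u')\<^sup>2"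
      "(x - c) \<bullet> (x - c) = (norm u)\<^sup>2"
      by (simp_all flip: power2_norm_eq_inner)
    then show ?thesis
      by (simp add: dist_norm power2_norm_eq_inner inner_diff_left inner_diff_right inner_commute algebra_simps)
  qed
  have h: "(dist c c')\<^sup>2 + (norm u)\<^sup>2 = (norm u')\<^sup>2" and h': "(dist c c')\<^sup>2 + (norm u')\<^sup>2 = (norm u)\<^sup>2"
    using half[OF f f' eq] half[OF f' f eq[symmetric]] by (simp_all add: dist_commute)
  have "(dist c c')\<^sup>2 = 0" using h h' by linarith
  then show "c = c'" by simp
  with h show "norm u = norm u'" by simp
qed

lemma circle_center_circle_loop:
  assumes "radius_frame u v"
  shows "circle_center (path_image (circle_loop c u v)) = c"
  unfolding circle_center_def
  using circle_center_radius_unique(1) assms by (intro some_equality) blast+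

text \<open>Turning the frame puts its first vector into a chosen direction of the circle's plane
  without changing the circle.\<close>

lemma circle_rotate_frame:
  assumes "radius_frame u v"
  shows "radius_frame (cos a *\<^sub>R u + sin a *\<^sub>R v) (cos a *\<^sub>R v - sin a *\<^sub>R u)" (is "radius_frame ?u ?v")
    and "path_image (circle_loop c (cos a *\<^sub>R u + sin a *\<^sub>R v) (cos a *\<^sub>R v - sin a *\<^sub>R u))
      = path_image (circle_loop c u v)"
    and "norm (cos a *\<^sub>R u + sin a *\<^sub>R v) = norm u"
proof -
  show nu: "norm ?u = norm u" by (simp add: norm_frame_combination[OF assms])
  have nv: "norm ?v = norm u"
    using norm_frame_combination[OF assms, of "- sin a" "cos a"] by simp
  have "?u \<bullet> ?v = 0"
    using assms unfolding radius_frame_def orthogonal_def norm_eq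
    by (simp add: inner_add_left inner_diff_right inner_commute algebra_simps)
  then show "radius_frame ?u ?v"
    using nu nv assms unfolding radius_frame_def orthogonal_def by (metis norm_eq_zero)
  have rot: "c + cos b *\<^sub>R ?u + sin b *\<^sub>R ?v = c + cos (a + b) *\<^sub>R u + sin (a + b) *\<^sub>R v" for b
    by (simp add: cos_add sin_add algebra_simps)
  have "range (\<lambda>b. c + cos (a + b) *\<^sub>R u + sin (a + b) *\<^sub>R v) = range (\<lambda>b. c + cos b *\<^sub>R u + sin b *\<^sub>R v)"
  proof (intro equalityI subsetI)
    fix x assume "x \<in> range (\<lambda>b. c + cos b *\<^sub>R u + sin b *\<^sub>R v)"
    then obtain b where "x = c + cos b *\<^sub>R u + sin b *\<^sub>R v" by blast
    then have "x = c + cos (a + (b - a)) *\<^sub>R u + sin (a + (b - a)) *\<^sub>R v" by simp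
    then show "x \<in> range (\<lambda>b. c + cos (a + b) *\<^sub>R u + sin (a + b) *\<^sub>R v)" by blast
  qed auto
  then show "path_image (circle_loop c ?u ?v) = path_image (circle_loop c u v)"
    by (simp add: path_image_circle_loop rot)
qed

lemma hull_circle_coordinates:
  assumes "x \<in> convex hull path_image (circle_loop c u v)"
  obtains s t where "x = c + s *\<^sub>R u + t *\<^sub>R v"
proof -
  let ?S = "range (\<lambda>(s, t). c + (s *\<^sub>R u + t *\<^sub>R v))"
  have "convex hull path_image (circle_loop c u v) \<subseteq> ?S"
  proof (rule hull_minimal)
    show "path_image (circle_loop c u v) \<subseteq> ?S"
      by (force simp: path_image_circle_loop add.assoc)
    show "convex ?S"
    proof (rule convexI)
      fix x y and a b :: real assume "x \<in> ?S" "y \<in> ?S" "a + b = 1"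
      then obtain s t s' t' where xy: "x = c + (s *\<^sub>R u + t *\<^sub>R v)" "y = c + (s' *\<^sub>R u + t' *\<^sub>R v)" by auto
      have "a *\<^sub>R c + b *\<^sub>R c = c" using \<open>a + b = 1\<close> by (simp flip: scaleR_add_left)
      then have "a *\<^sub>R x + b *\<^sub>R y = c + ((a * s + b * s') *\<^sub>R u + (a * t + b * t') *\<^sub>R v)"
        by (simp add: xy algebra_simps)
      then show "a *\<^sub>R x + b *\<^sub>R y \<in> ?S" by auto
    qed
  qed
  with assms have "x \<in> ?S" by blast
  then obtain s t where "x = c + (s *\<^sub>R u + t *\<^sub>R v)" by auto
  then show ?thesis using that[of s t] by (simp add: add.assoc)
qed

section \<open>Solid tori as tubes around circles\<close>

definition tube :: "(real^3) set \<Rightarrow> real \<Rightarrow> (real^3) set" where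
  "tube C r = {x. \<exists>y\<in>C. dist x y \<le> r}"

section \<open>Lines, rotations about an axis, and revolved disks\<close>

lemma straight_line_param:
  assumes "straight_line l"
  obtains p n where "norm n = 1" "l = range (\<lambda>t. p + t *\<^sub>R n)"
proof -
  have l: "affine l" "aff_dim l = 1" using assms by (auto simp: straight_line_def)
  obtain B where B: "affine hull B = affine hull l" "int (card B) = aff_dim l + 1"
    using aff_dim_basis_exists by metis
  then have "card B = 2" using l by simp
  then obtain a b where ab: "B = {a, b}" "a \<noteq> b" by (auto simp: card_2_iff)
  define n where "n = (1 / norm (b - a)) *\<^sub>R (b - a)"
  have n: "norm n = 1" using ab by (simp add: n_def)
  have "l = affine hull {a, b}" using B(1) ab l by (metis affine_hull_eq)
  also have "\<dots> = range (\<lambda>t. a + t *\<^sub>R n)"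
  proof (intro equalityI subsetI)
    fix x assume "x \<in> affine hull {a, b}"
    then obtain s t where "x = s *\<^sub>R a + t *\<^sub>R b" "s + t = 1" by (auto simp: affine_hull_2)
    moreover have "t *\<^sub>R (b - a) = (t * norm (b - a)) *\<^sub>R n" using ab by (simp add: n_def)
    moreover have "s = 1 - t" using \<open>s + t = 1\<close> by simp
    ultimately have "x = a + (t * norm (b - a)) *\<^sub>R n" by (simp add: algebra_simps)
    then show "x \<in> range (\<lambda>t. a + t *\<^sub>R n)" by blast
  next
    fix x assume "x \<in> range (\<lambda>t. a + t *\<^sub>R n)"
    then obtain t where "x = a + t *\<^sub>R n" by blast
    then have "x = (1 - t / norm (b - a)) *\<^sub>R a + (t / norm (b - a)) *\<^sub>R b"
      by (simp add: n_def algebra_simps)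
    then show "x \<in> affine hull {a, b}" unfolding affine_hull_2
      by (intro CollectI exI conjI) auto
  qed
  finally show ?thesis using n that by blast
qed

text \<open>Rodrigues' formula for the rotation by the angle \<open>a\<close> about the direction of
  the unit vector \<open>n\<close>.\<close>

definition axis_rotation :: "real^3 \<Rightarrow> real \<Rightarrow> real^3 \<Rightarrow> real^3" where
  "axis_rotation n a y = (n \<bullet> y) *\<^sub>R n + cos a *\<^sub>R (y - (n \<bullet> y) *\<^sub>R n) + sin a *\<^sub>R cross3 n y"

lemma linear_axis_rotation: "linear (axis_rotation n a)"
  unfolding axis_rotation_def
  by (intro linearI) (simp_all add: inner_add_right cross_add_right cross_mult_right algebra_simps)

lemma cross_cross_self:
  assumes "norm n = 1"
  shows "cross3 n (cross3 n y) = (n \<bullet> y) *\<^sub>R n - y"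
  using assms by (simp add: Lagrange norm_eq_1)

lemma axis_rotation_compose:
  assumes "norm n = 1"
  shows "axis_rotation n a (axis_rotation n b y) = axis_rotation n (a + b) y"
proof -
  have "n \<bullet> axis_rotation n b y = n \<bullet> y"
    using assms by (simp add: axis_rotation_def inner_add_right inner_diff_right norm_eq_1 dot_cross_self)
  moreover have "cross3 n (axis_rotation n b y) = cos b *\<^sub>R cross3 n y + sin b *\<^sub>R ((n \<bullet> y) *\<^sub>R n - y)"
    unfolding axis_rotation_def
    by (simp add: cross_add_right cross_mult_right cross_cross_self[OF assms] right_diff_distrib cross_minus_right
          left_diff_distrib diff_conv_add_uminus del: add_uminus_conv_diff)
  ultimately have "axis_rotation n a (axis_rotation n b y) =
      (n \<bullet> y) *\<^sub>R n + cos a *\<^sub>R (axis_rotation n b y - (n \<bullet> y) *\<^sub>R n)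
      + sin a *\<^sub>R (cos b *\<^sub>R cross3 n y + sin b *\<^sub>R ((n \<bullet> y) *\<^sub>R n - y))"
    unfolding axis_rotation_def[of n a "axis_rotation n b y"] by (simp only:)
  then show ?thesis
    by (simp add: axis_rotation_def cos_add sin_add algebra_simps)
qed

lemma norm_axis_rotation:
  assumes "norm n = 1"
  shows "norm (axis_rotation n a y) = norm y"
proof -
  define w where "w = y - (n \<bullet> y) *\<^sub>R n"
  have n: "n \<bullet> n = 1" using assms by (simp add: norm_eq_1)
  have nw: "n \<bullet> w = 0" by (simp add: w_def inner_diff_right n)
  have cw: "cross3 n y = cross3 n w"
    by (simp add: w_def cross_minus_right cross_add_right cross_mult_right diff_conv_add_uminus del: add_uminus_conv_diff)
  have cc: "cross3 n w \<bullet> cross3 n w = w \<bullet> w"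
    using norm_cross[of n w] by (simp add: assms nw power2_norm_eq_inner)
  have g: "axis_rotation n a y = (n \<bullet> y) *\<^sub>R n + (cos a *\<^sub>R w + sin a *\<^sub>R cross3 n w)"
    by (simp add: axis_rotation_def w_def[symmetric] cw)
  have "axis_rotation n a y \<bullet> axis_rotation n a y = (n \<bullet> y)\<^sup>2 + ((cos a)\<^sup>2 + (sin a)\<^sup>2) * (w \<bullet> w)"
    unfolding g using nw n cc dot_cross_self[of n w]
    by (simp add: inner_add_left inner_add_right inner_commute power2_eq_square algebra_simps
             del: sin_cos_squared_add sin_cos_squared_add2 sin_cos_squared_add3)
  also have "\<dots> = y \<bullet> y"
    by (simp add: w_def inner_diff_left inner_diff_right inner_commute n power2_eq_square algebra_simps)
  finally show ?thesis by (simp add: norm_eq_sqrt_inner)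
qed

lemma rotation_about_axis_rotation:
  assumes n: "norm n = 1" and l: "l = range (\<lambda>t. c + t *\<^sub>R n)"
  shows "rotation_about l (\<lambda>x. c + axis_rotation n a (x - c))"
proof -
  have orth: "orthogonal_transformation (axis_rotation n b)" for b
    using linear_axis_rotation norm_axis_rotation[OF n] by (simp add: orthogonal_transformation)
  \<comment> \<open>A rotation is the square of the rotation by half the angle, so its determinant
    is the square of 1 or -1.\<close>
  have sq: "axis_rotation n a = axis_rotation n (a / 2) \<circ> axis_rotation n (a / 2)"
    using axis_rotation_compose[OF n, of "a / 2" "a / 2"] by (auto simp: fun_eq_iff)
  have "orthogonal_matrix (matrix (axis_rotation n (a / 2)))"
    using orth orthogonal_transformation_matrix by blast
  then have "det (matrix (axis_rotation n (a / 2))) = 1 \<or> det (matrix (axis_rotation n (a / 2))) = - 1"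
    by (rule det_orthogonal_matrix)
  then have "det (matrix (axis_rotation n a)) = 1"
    unfolding sq using linear_axis_rotation by (auto simp: matrix_compose det_mul)
  moreover have "c + axis_rotation n a (x - c) = x" if "x \<in> l" for x
    using that n by (auto simp: l axis_rotation_def norm_eq_1 cross_mult_right)
  ultimately show ?thesis using orth unfolding rotation_about_def by blast
qed

lemma rotation_about_isometry:
  assumes "rotation_about l f"
  shows "dist (f x) (f y) = dist x y"
proof -
  obtain p g where g: "orthogonal_transformation g" "f = (\<lambda>x. p + g (x - p))"
    using assms unfolding rotation_about_def by blast
  then have "f x - f y = g (x - y)"
    using linear_diff[of g "x - p" "y - p"] by (simp add: orthogonal_transformation)
  then show ?thesis using g by (simp add: dist_norm orthogonal_transformation)
qed

text \<open>Polar coordinates in the plane perpendicular to \<open>n\<close>, in the orthogonal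
  basis \<open>u\<close>, \<open>cross3 n u\<close> of vectors of equal length; the radius
  \<open>k\<close> is measured in units of the norm of \<open>u\<close>.\<close>

lemma polar_perp:
  fixes n u y :: "real^3"
  assumes n: "norm n = 1" and u: "n \<bullet> u = 0" "u \<noteq> 0" and y: "n \<bullet> y = 0"
  obtains k a where "k \<ge> 0" "y = k *\<^sub>R (cos a *\<^sub>R u + sin a *\<^sub>R cross3 n u)"
proof -
  define v where "v = cross3 n u"
  define N where "N = u \<bullet> u"
  have N: "N > 0" using u by (simp add: N_def)
  have vv: "v \<bullet> v = N"
    using norm_cross[of n u] by (simp add: v_def N_def n u power2_norm_eq_inner)
  have uv: "u \<bullet> v = 0" and nv: "n \<bullet> v = 0" by (simp_all add: v_def dot_cross_self)
  \<comment> \<open>Up to the factor \<open>- N\<close>, this is the error of the orthogonal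
    expansion of \<open>y\<close>. It is orthogonal to \<open>n\<close>, \<open>u\<close> and
    \<open>v\<close>, and \<open>triple_identity\<close> then makes it zero.\<close>
  define z where "z = (y \<bullet> u) *\<^sub>R u + (y \<bullet> v) *\<^sub>R v - N *\<^sub>R y"
  have "z \<bullet> n = 0" "z \<bullet> u = 0" "z \<bullet> v = 0"
    using u y uv nv vv by (simp_all add: z_def N_def inner_add_left inner_diff_left inner_add_right inner_diff_right inner_commute[of _ n] inner_commute[of v u])
  then have "(z \<bullet> z) * (n \<bullet> cross3 u v) = 0"
    using triple_identity[of z n u v] by simp
  moreover have "n \<bullet> cross3 u v = N"
    using cross_triple[of n u v] vv by (simp add: v_def inner_commute)
  ultimately have "z = 0" using N by simp
  then have "N *\<^sub>R y = (y \<bullet> u) *\<^sub>R u + (y \<bullet> v) *\<^sub>R v" by (simp add: z_def)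
  then have "(1 / N) *\<^sub>R N *\<^sub>R y = (1 / N) *\<^sub>R ((y \<bullet> u) *\<^sub>R u + (y \<bullet> v) *\<^sub>R v)" by simp
  then have yuv: "y = ((y \<bullet> u) / N) *\<^sub>R u + ((y \<bullet> v) / N) *\<^sub>R v"
    using N by (simp add: scaleR_add_right)
  let ?z = "Complex ((y \<bullet> u) / N) ((y \<bullet> v) / N)"
  have "?z = rcis (cmod ?z) (Arg ?z)" by (simp add: rcis_cmod_Arg)
  then have "(y \<bullet> u) / N = cmod ?z * cos (Arg ?z)" "(y \<bullet> v) / N = cmod ?z * sin (Arg ?z)"
    by (metis Re_rcis complex.sel(1)) (metis Im_rcis complex.sel(2) \<open>?z = rcis (cmod ?z) (Arg ?z)\<close>)
  then have "y = cmod ?z *\<^sub>R (cos (Arg ?z) *\<^sub>R u + sin (Arg ?z) *\<^sub>R cross3 n u)"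
    using yuv by (simp add: v_def scaleR_add_right)
  then show ?thesis using that[of "cmod ?z" "Arg ?z"] by simp
qed

text \<open>Rotations are isometries, so a revolved point stays within \<open>r\<close> of the image
  of \<open>Q\<close>. Conversely, a point of the tube is turned back into the half-plane of
  \<open>Q\<close> bounded by \<open>l\<close>, where \<open>Q\<close> is the nearest point of the
  circle.\<close>

lemma solid_torus_of_tube:
  assumes "solid_torus_of P l Q r T"
  obtains c u v where "radius_frame u v" "revolve l {Q} = path_image (circle_loop c u v)"
    "0 < r" "r < norm u" "T = tube (path_image (circle_loop c u v)) r"
proof -
  have P: "affine P" "l \<subseteq> P" "Q \<in> P" and l: "straight_line l" and r: "0 < r" "r < infdist Q l"
    and T: "T = revolve l (cball Q r \<inter> P)"
    using assms by (auto simp: solid_torus_of_def)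
  obtain p n where n: "norm n = 1" and lp: "l = range (\<lambda>t. p + t *\<^sub>R n)"
    using straight_line_param[OF l] by blast
  have nn: "n \<bullet> n = 1" using n by (simp add: norm_eq_1)
  \<comment> \<open>The foot of the perpendicular from \<open>Q\<close> to the line
    \<open>l\<close>.\<close>
  define c where "c = p + (n \<bullet> (Q - p)) *\<^sub>R n"
  define u where "u = Q - c"
  define v where "v = cross3 n u"
  have lc: "l = range (\<lambda>t. c + t *\<^sub>R n)"
  proof -
    have "p + t *\<^sub>R n = c + (t - n \<bullet> (Q - p)) *\<^sub>R n" for t by (simp add: c_def algebra_simps)
    moreover have "c + t *\<^sub>R n = p + (t + n \<bullet> (Q - p)) *\<^sub>R n" for t by (simp add: c_def algebra_simps)
    ultimately show ?thesis unfolding lp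
      by (intro equalityI image_subsetI) (metis rangeI)+
  qed
  have nu: "n \<bullet> u = 0" by (simp add: u_def c_def inner_diff_right inner_add_right nn)
  have cl: "c + t *\<^sub>R n \<in> l" for t using lc by blast
  have "infdist Q l \<le> dist Q c" using infdist_le cl[of 0] by fastforce
  then have ru: "r < norm u" using r by (simp add: u_def dist_norm)
  then have u0: "u \<noteq> 0" using r by auto
  have nvu: "norm v = norm u"
    using norm_cross[of n u] n nu by (simp add: v_def)
  have frame: "radius_frame u v"
    using u0 nvu by (simp add: radius_frame_def v_def orthogonal_def dot_cross_self)
  have rot: "axis_rotation n a (h *\<^sub>R n + k *\<^sub>R u) = h *\<^sub>R n + k *\<^sub>R (cos a *\<^sub>R u + sin a *\<^sub>R v)" for a h k
    by (simp add: axis_rotation_def inner_add_right nn nu v_def cross_add_right cross_mult_right algebra_simps)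
  let ?C = "path_image (circle_loop c u v)"
  have C: "?C = range (\<lambda>a. c + (cos a *\<^sub>R u + sin a *\<^sub>R v))"
    by (simp add: path_image_circle_loop add.assoc)
  have fQ: "f Q \<in> ?C" if f: "rotation_about l f" for f
  proof -
    define y where "y = f Q - c"
    \<comment> \<open>A rotation fixes the axis pointwise and so preserves distances to its points.
      The parameters 0 and 1 already determine the length of \<open>y\<close> and its component
      along \<open>n\<close>.\<close>
    have d: "dist (f Q) (c + t *\<^sub>R n) = dist Q (c + t *\<^sub>R n)" for t
      using rotation_about_isometry[OF f, of Q "c + t *\<^sub>R n"] f cl[of t] unfolding rotation_about_def by metis
    have e: "norm (y - t *\<^sub>R n) = norm (u - t *\<^sub>R n)" for t
      using d[of t] by (simp add: dist_norm y_def u_def diff_diff_eq)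
    have e0: "y \<bullet> y = u \<bullet> u" using e[of 0] by (simp add: norm_eq)
    have "(y - n) \<bullet> (y - n) = (u - n) \<bullet> (u - n)" using e[of 1] by (simp add: norm_eq)
    then have "n \<bullet> y = 0" using e0 nu nn
      by (simp add: inner_diff_left inner_diff_right inner_commute)
    then obtain k a where k: "k \<ge> 0" "y = k *\<^sub>R (cos a *\<^sub>R u + sin a *\<^sub>R v)"
      using polar_perp[OF n nu u0] v_def by metis
    have "norm y = k * norm u" using k by (simp add: norm_frame_combination[OF frame])
    moreover have "norm y = norm u" using e0 by (simp add: norm_eq)
    ultimately have "k = 1" using u0 by simp
    then have "f Q = c + (cos a *\<^sub>R u + sin a *\<^sub>R v)" using k by (simp add: y_def algebra_simps)
    then show ?thesis unfolding C by blast
  qed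
  have rev: "revolve l {Q} = ?C"
  proof (intro equalityI subsetI)
    fix x assume "x \<in> revolve l {Q}" then show "x \<in> ?C" using fQ by (auto simp: revolve_def)
  next
    fix x assume "x \<in> ?C"
    then obtain a where a: "x = c + (cos a *\<^sub>R u + sin a *\<^sub>R v)" unfolding C by blast
    have "c + axis_rotation n a (Q - c) = x" using rot[of a 0 1] by (simp add: a flip: u_def)
    then show "x \<in> revolve l {Q}"
      using rotation_about_axis_rotation[OF n lc, of a] by (auto simp: revolve_def)
  qed
  have "T = tube ?C r"
  proof (intro equalityI subsetI)
    fix x assume "x \<in> T"
    then obtain f z where f: "rotation_about l f" and z: "dist Q z \<le> r" and x: "x = f z"
      unfolding T revolve_def by auto
    then show "x \<in> tube ?C r"
      using fQ[OF f] rotation_about_isometry[OF f, of z Q] unfolding tube_def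
      by (auto simp: dist_commute intro!: bexI[of _ "f Q"])
  next
    fix x assume "x \<in> tube ?C r"
    then obtain b where b: "dist x (c + (cos b *\<^sub>R u + sin b *\<^sub>R v)) \<le> r" unfolding tube_def C by auto
    define h where "h = n \<bullet> (x - c)"
    have "n \<bullet> (x - c - h *\<^sub>R n) = 0" by (simp add: h_def inner_diff_right nn)
    then obtain k a where k: "k \<ge> 0" "x - c - h *\<^sub>R n = k *\<^sub>R (cos a *\<^sub>R u + sin a *\<^sub>R v)"
      using polar_perp[OF n nu u0] v_def by metis
    have x: "x = c + (h *\<^sub>R n + k *\<^sub>R (cos a *\<^sub>R u + sin a *\<^sub>R v))"
      using k(2) by (simp add: algebra_simps)
    \<comment> \<open>\<open>z\<close> has the same height \<open>h\<close> and distance from the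
      axis as \<open>x\<close>, but lies on the side of \<open>Q\<close>, at angle 0.\<close>
    define z where "z = c + (h *\<^sub>R n + k *\<^sub>R u)"
    have xz: "x = c + axis_rotation n a (z - c)" by (simp add: x z_def rot)
    have "z = (1 - h - k) *\<^sub>R c + h *\<^sub>R (c + 1 *\<^sub>R n) + k *\<^sub>R Q"
      by (simp add: z_def u_def algebra_simps)
    moreover have "c \<in> P" "c + 1 *\<^sub>R n \<in> P" using cl[of 0] cl[of 1] P by auto
    ultimately have zP: "z \<in> P" using mem_affine_3[OF P(1), of c "c + 1 *\<^sub>R n" Q] P(3) by simp
    have nrm: "(norm (h *\<^sub>R n + (s *\<^sub>R u + t *\<^sub>R v)))\<^sup>2 = h\<^sup>2 + (norm u)\<^sup>2 * (s\<^sup>2 + t\<^sup>2)" for s t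
      using n nu norm_frame_combination[OF frame, of s t]
      by (subst norm_add_Pythagorean)
         (auto simp: orthogonal_def inner_add_right v_def dot_cross_self power_mult_distrib)
    have "z - Q = h *\<^sub>R n + ((k - 1) *\<^sub>R u + 0 *\<^sub>R v)" by (simp add: z_def u_def algebra_simps)
    then have zQ: "(dist z Q)\<^sup>2 = h\<^sup>2 + (norm u)\<^sup>2 * (k - 1)\<^sup>2" using nrm[of "k - 1" 0] by (simp add: dist_norm)
    have "x - (c + (cos b *\<^sub>R u + sin b *\<^sub>R v)) = h *\<^sub>R n + ((k * cos a - cos b) *\<^sub>R u + (k * sin a - sin b) *\<^sub>R v)"
      by (simp add: x algebra_simps)
    then have xb: "(dist x (c + (cos b *\<^sub>R u + sin b *\<^sub>R v)))\<^sup>2 =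
        h\<^sup>2 + (norm u)\<^sup>2 * ((k * cos a - cos b)\<^sup>2 + (k * sin a - sin b)\<^sup>2)"
      using nrm by (simp add: dist_norm)
    \<comment> \<open>The law of cosines in the plane of the circle: for \<open>k \<ge> 0\<close>
      the distance to a circle point is least when the angles agree.\<close>
    have "(k * cos a - cos b)\<^sup>2 + (k * sin a - sin b)\<^sup>2
       = k\<^sup>2 * ((cos a)\<^sup>2 + (sin a)\<^sup>2) + ((cos b)\<^sup>2 + (sin b)\<^sup>2) - 2 * k * (cos a * cos b + sin a * sin b)"
      by algebra
    also have "\<dots> = k\<^sup>2 + 1 - 2 * k * cos (a - b)" by (simp add: cos_diff)
    also have "\<dots> \<ge> k\<^sup>2 + 1 - 2 * k"
      using k(1) cos_le_one[of "a - b"] by (simp add: mult_left_le)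
    finally have "(k - 1)\<^sup>2 \<le> (k * cos a - cos b)\<^sup>2 + (k * sin a - sin b)\<^sup>2"
      by (simp add: power2_diff)
    then have "(dist z Q)\<^sup>2 \<le> (dist x (c + (cos b *\<^sub>R u + sin b *\<^sub>R v)))\<^sup>2"
      unfolding zQ xb by (intro add_left_mono mult_left_mono) auto
    then have "dist z Q \<le> r" using b by (meson order_trans power2_le_imp_le zero_le_dist)
    then show "x \<in> T"
      using zP xz rotation_about_axis_rotation[OF n lc, of a]
      unfolding T revolve_def by (auto simp: dist_commute)
  qed
  then show ?thesis using that frame rev r(1) ru by blast
qed

text \<open>\<open>central_circle\<close> selects the circle of some presentation of
  \<open>T\<close>; frame, tube radius and set are all read off from this one presentation and
  therefore fit together.\<close>

lemma standard_solid_torus_tube: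
  assumes "standard_solid_torus T"
  obtains u v r where "radius_frame u v" "central_circle T = path_image (circle_loop (torus_center T) u v)"
    "0 < r" "r < norm u" "T = tube (central_circle T) r"
proof -
  have "\<exists>C P l Q r. solid_torus_of P l Q r T \<and> C = revolve l {Q}"
    using assms unfolding standard_solid_torus_def by blast
  then have "\<exists>P l Q r. solid_torus_of P l Q r T \<and> central_circle T = revolve l {Q}"
    unfolding central_circle_def by (rule someI_ex)
  then obtain P l Q r where t: "solid_torus_of P l Q r T" "central_circle T = revolve l {Q}" by blast
  obtain c u v where *: "radius_frame u v" "revolve l {Q} = path_image (circle_loop c u v)"
    "0 < r" "r < norm u" "T = tube (path_image (circle_loop c u v)) r"
    using solid_torus_of_tube[OF t(1)] by blast
  moreover have "torus_center T = c"
    using * t circle_center_circle_loop by (simp add: torus_center_def)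
  ultimately show ?thesis using that t by simp
qed

lemma subset_tube: "0 \<le> r \<Longrightarrow> C \<subseteq> tube C r"
  unfolding tube_def by (metis (mono_tags, lifting) dist_self mem_Collect_eq subsetI)

text \<open>As a Minkowski sum with a ball, a tube inherits compactness and connectedness from its
  circle.\<close>

lemma tube_eq_image: "tube C r = (\<lambda>(x, y). x + y) ` (C \<times> cball 0 r)"
proof (intro equalityI subsetI)
  fix x assume "x \<in> tube C r"
  then obtain y where "y \<in> C" "dist x y \<le> r" by (auto simp: tube_def)
  then show "x \<in> (\<lambda>(x, y). x + y) ` (C \<times> cball 0 r)"
    by (intro image_eqI[of _ _ "(y, x - y)"]) (auto simp: dist_norm norm_minus_commute)
next
  fix x assume "x \<in> (\<lambda>(x, y). x + y) ` (C \<times> cball 0 r)"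
  then obtain y z where "y \<in> C" "norm z \<le> r" "x = y + z" by auto
  then show "x \<in> tube C r" unfolding tube_def by (auto simp: dist_norm intro!: bexI[of _ y])
qed

lemma compact_path_image_circle: "compact (path_image (circle_loop c u v))"
  and connected_path_image_circle: "connected (path_image (circle_loop c u v))"
proof -
  have "continuous_on {0..1} (circle_loop c u v)"
    unfolding circle_loop_def by (intro continuous_intros)
  then show "compact (path_image (circle_loop c u v))" "connected (path_image (circle_loop c u v))"
    unfolding path_image_def by (auto intro: compact_continuous_image connected_continuous_image)
qed

lemma compact_tube: "compact C \<Longrightarrow> compact (tube C r)"
  unfolding tube_eq_image case_prod_beta
  by (intro compact_continuous_image continuous_intros compact_Times) auto

lemma connected_tube: "connected C \<Longrightarrow> connected (tube C r)"
  unfolding tube_eq_image case_prod_beta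
  by (intro connected_continuous_image continuous_intros connected_Times) auto

lemma standard_solid_torus_compact: "standard_solid_torus T \<Longrightarrow> compact T"
  by (metis standard_solid_torus_tube compact_tube compact_path_image_circle)

lemma standard_solid_torus_connected: "standard_solid_torus T \<Longrightarrow> connected T"
  by (metis standard_solid_torus_tube connected_tube connected_path_image_circle)

section \<open>Null-homotopic circles inside a tube\<close>

text \<open>A point of the axis differs from \<open>c\<close> by a vector orthogonal to every
  radius, so by Cauchy-Schwarz its distance from each circle point is at least the norm of
  \<open>u\<close>, which exceeds \<open>r\<close>.\<close>

lemma tube_avoids_axis:
  assumes f: "radius_frame u v" and r: "r < norm u" and x: "x \<in> tube (path_image (circle_loop c u v)) r"
  shows "(x - c) \<bullet> u \<noteq> 0 \<or> (x - c) \<bullet> v \<noteq> 0"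
proof (rule ccontr)
  assume "\<not> ?thesis"
  then have o: "(x - c) \<bullet> u = 0" "(x - c) \<bullet> v = 0" by auto
  obtain a where a: "dist x (c + cos a *\<^sub>R u + sin a *\<^sub>R v) \<le> r"
    using x by (auto simp: tube_def path_image_circle_loop)
  define w where "w = cos a *\<^sub>R u + sin a *\<^sub>R v"
  have w: "norm w = norm u" by (simp add: w_def norm_frame_combination[OF f])
  have "(w - (x - c)) \<bullet> w = (norm w)\<^sup>2"
    using o by (simp add: inner_diff_left power2_norm_eq_inner) (simp add: w_def inner_add_right)
  then have "(norm w)\<^sup>2 \<le> norm (w - (x - c)) * norm w"
    by (metis norm_cauchy_schwarz)
  also have "norm (w - (x - c)) = dist x (c + cos a *\<^sub>R u + sin a *\<^sub>R v)"
    by (simp add: w_def dist_norm norm_minus_commute algebra_simps)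
  finally have "norm w * norm w \<le> dist x (c + cos a *\<^sub>R u + sin a *\<^sub>R v) * norm w"
    by (simp add: power2_eq_square)
  moreover have "norm w > 0" using f w by (metis radius_frame_def zero_less_norm_iff)
  ultimately have "norm w \<le> r" using a by (simp only: mult_le_cancel_right_pos)
  then show False using w r by simp
qed

text \<open>Composing the homotopy with \<open>F\<close> contracts the plane loop inside the
  punctured plane. This makes null-homotopy in a tube refutable by a winding number about the
  axis.\<close>

lemma winding_number_nullhomotopic_image:
  assumes hom: "homotopic_with_canon (\<lambda>h. True) S T (\<lambda>x. x) (\<lambda>x. a)"
    and p: "path p" "path_image p \<subseteq> S" "pathfinish p = pathstart p"
    and F: "continuous_on T F" "\<And>x. x \<in> T \<Longrightarrow> F x \<noteq> (0::complex)"
  shows "winding_number (F \<circ> p) 0 = 0"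
proof -
  obtain h where h: "continuous_on ({0..1::real} \<times> S) h" "h ` ({0..1} \<times> S) \<subseteq> T"
    "\<And>x. x \<in> S \<Longrightarrow> h (0, x) = x" "\<And>x. x \<in> S \<Longrightarrow> h (1, x) = a"
    using hom unfolding homotopic_with by (auto simp: homotopic_with image_subset_iff_funcset)
  have pS: "p t \<in> S" if "t \<in> {0..1}" for t using p(2) that by (auto simp: path_image_def)
  have aT: "a \<in> T" using h(2) h(4)[of "p 0"] pS[of 0] by (force simp: image_subset_iff)
  have cp: "continuous_on {0..1} p" using p(1) by (simp add: path_def)
  have "homotopic_loops (- {0}) (F \<circ> p) (\<lambda>t. F a)"
    unfolding homotopic_loops
  proof (intro exI[of _ "\<lambda>x. F (h (fst x, p (snd x)))"] conjI ballI)
    show "continuous_on ({0..1} \<times> {0..1}) (\<lambda>x. F (h (fst x, p (snd x))))"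
    proof (rule continuous_on_compose2[OF F(1)], rule continuous_on_compose2[OF h(1)])
      show "continuous_on ({0..1} \<times> {0..1}) (\<lambda>x. (fst x, p (snd x)))"
        by (intro continuous_intros continuous_on_compose2[OF cp]) auto
    qed (use h(2) pS in \<open>auto simp: image_subset_iff\<close>)
    show "(\<lambda>x. F (h (fst x, p (snd x)))) \<in> {0..1} \<times> {0..1} \<rightarrow> - {0}"
      using h(2) pS F(2) by (auto simp: image_subset_iff)
  qed (use h pS p(3) in \<open>auto simp: pathfinish_def pathstart_def\<close>)
  then have "winding_number (F \<circ> p) 0 = winding_number (\<lambda>t. F a) 0"
    by (rule winding_number_homotopic_loops)
  also have "\<dots> = 0" using F(2) aT by (intro winding_number_zero_const) auto
  finally show ?thesis .
qed

text \<open>Choose a radius \<open>W\<close> of the small circle in the meridional plane through its center. If \<open>c' + W\<close>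
  lay beyond the axis of the tube, the disk of the small circle would meet the axis, and the circle
  would either meet the axis itself or, projected along the axis, wind once around it.\<close>

lemma nullhomotopic_circle_radius:
  fixes c u v c' u' v' :: "real^3"
  defines "C \<equiv> path_image (circle_loop c u v)" and "C' \<equiv> path_image (circle_loop c' u' v')"
  assumes f: "radius_frame u v" and f': "radius_frame u' v'" and r: "0 < r" "r < norm u"
    and c': "c' \<in> C" and sub: "C' \<subseteq> tube C r"
    and hom: "homotopic_with_canon (\<lambda>h. True) C' (tube C r) (\<lambda>x. x) (\<lambda>x. a)"
  shows "norm u' \<le> r"
proof -
  obtain e where e: "c' = c + cos e *\<^sub>R u + sin e *\<^sub>R v"
    using c' by (auto simp: C_def path_image_circle_loop)
  \<comment> \<open>The frame is turned so that \<open>c'\<close> lies in the direction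
    \<open>U\<close>; the meridional plane through \<open>c'\<close> is then the plane through
    \<open>c\<close> orthogonal to \<open>V\<close>.\<close>
  define U where "U = cos e *\<^sub>R u + sin e *\<^sub>R v"
  define V where "V = cos e *\<^sub>R v - sin e *\<^sub>R u"
  have fU: "radius_frame U V" and CU: "C = path_image (circle_loop c U V)" and nU: "norm U = norm u"
    unfolding U_def V_def C_def by (simp_all add: circle_rotate_frame[OF f])
  have c'U: "c' = c + U" by (simp add: e U_def)
  have UV: "U \<bullet> V = 0" "V \<bullet> U = 0" using fU by (auto simp: radius_frame_def orthogonal_def inner_commute)
  let ?z = "Complex (u' \<bullet> V) (v' \<bullet> V)"
  \<comment> \<open>The \<open>V\<close>-component of the radius at angle \<open>b\<close> is a
    multiple of the cosine of \<open>b - Arg ?z\<close>; a quarter turn after \<open>Arg ?z\<close>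
    it is zero.\<close>
  define b0 where "b0 = Arg ?z + pi / 2"
  have "?z = rcis (cmod ?z) (Arg ?z)" by (simp add: rcis_cmod_Arg)
  then have z: "u' \<bullet> V = cmod ?z * cos (Arg ?z)" "v' \<bullet> V = cmod ?z * sin (Arg ?z)"
    by (metis Re_rcis complex.sel(1)) (metis Im_rcis complex.sel(2) \<open>?z = rcis (cmod ?z) (Arg ?z)\<close>)
  have b0: "(cos b0 *\<^sub>R u' + sin b0 *\<^sub>R v') \<bullet> V = 0"
    unfolding inner_add_left inner_scaleR_left by (subst z(1), subst z(2)) (simp add: b0_def cos_add sin_add)
  \<comment> \<open>The opposite radius is also meridional; the one chosen does not point away from
    the axis.\<close>
  define b where "b = (if (cos b0 *\<^sub>R u' + sin b0 *\<^sub>R v') \<bullet> U \<le> 0 then b0 else b0 + pi)"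
  define W where "W = cos b *\<^sub>R u' + sin b *\<^sub>R v'"
  define X where "X = cos b *\<^sub>R v' - sin b *\<^sub>R u'"
  have fW: "radius_frame W X" and CW: "C' = path_image (circle_loop c' W X)" and nW: "norm W = norm u'"
    unfolding W_def X_def C'_def by (simp_all add: circle_rotate_frame[OF f'])
  have WV: "W \<bullet> V = 0" using b0 by (simp add: W_def b_def inner_add_left)
  have WU: "W \<bullet> U \<le> 0" using b0 by (auto simp: W_def b_def inner_add_left)
  have inC': "c' + cos t *\<^sub>R W + sin t *\<^sub>R X \<in> C'" for t
    unfolding CW path_image_circle_loop by blast
  have avoid: "(x - c) \<bullet> U \<noteq> 0 \<or> (x - c) \<bullet> V \<noteq> 0" if "x \<in> tube C r" for x
    using tube_avoids_axis[OF fU, of r x c] that r nU CU by simp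
  have UU: "U \<bullet> U > 0" using fU by (simp add: radius_frame_def)
  \<comment> \<open>\<open>(c' + W - c) \<bullet> U\<close> equals this sum, so the claim is that
    the radius \<open>W\<close> ends before it reaches the axis.\<close>
  have pos: "U \<bullet> U + W \<bullet> U > 0"
  proof (rule ccontr)
    assume n: "\<not> ?thesis"
    define A where "A = W \<bullet> U"
    define B where "B = X \<bullet> U"
    define D where "D = X \<bullet> V"
    have A: "A < 0" "U \<bullet> U + A \<le> 0" using n UU unfolding A_def by linarith+
    show False
    proof (cases "D = 0")
      \<comment> \<open>Here the small circle lies in the meridional plane and has points on both
        closed sides of the axis, so it meets the axis.\<close>
      case True
      have "U \<bullet> U + cos 0 * A + sin 0 * B \<le> 0" using A by simp
      moreover have "0 \<le> U \<bullet> U + cos pi * A + sin pi * B" using A UU unfolding cos_pi sin_pi by linarith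
      ultimately have "\<exists>t\<ge>0. t \<le> pi \<and> U \<bullet> U + cos t * A + sin t * B = 0"
        by (rule IVT'[of "\<lambda>t. U \<bullet> U + cos t * A + sin t * B" 0 0 pi])
           (auto intro!: continuous_intros)
      then obtain t where t: "U \<bullet> U + cos t * A + sin t * B = 0" by blast
      define x where "x = c' + cos t *\<^sub>R W + sin t *\<^sub>R X"
      have "(x - c) \<bullet> U = 0" "(x - c) \<bullet> V = 0"
        using t True WV UV by (simp_all add: x_def c'U A_def B_def D_def inner_add_left)
      moreover have "x \<in> tube C r" using inC' sub x_def by blast
      ultimately show False using avoid by blast
    next
      case False
      \<comment> \<open>The radius from \<open>c'\<close> to \<open>c' + W\<close> crosses the axis
        in \<open>p\<close>. The tube avoids the axis, so \<open>p\<close> is not the endpoint and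
        \<open>t < 1\<close>.\<close>
      define t where "t = - (U \<bullet> U) / A"
      define p where "p = c' + t *\<^sub>R W"
      have pc: "(p - c) \<bullet> U = 0" "(p - c) \<bullet> V = 0"
        using A WV UV by (simp_all add: p_def c'U t_def inner_add_left inner_diff_left A_def)
      have t: "0 < t" unfolding t_def by (rule divide_neg_neg) (use A UU in linarith)+
      have "t \<le> 1" unfolding t_def neg_divide_le_eq[OF A(1)] using A(2) by linarith
      have "t \<noteq> 1"
      proof
        assume "t = 1"
        then have "p \<in> C'" using inC'[of 0] by (simp add: p_def)
        then show False using avoid pc sub by blast
      qed
      with \<open>t \<le> 1\<close> have t1: "t < 1" by simp
      \<comment> \<open>\<open>F\<close> projects along the axis, takes \<open>p\<close> as origin,
        and sends \<open>W\<close> to 1 and \<open>X\<close> to the imaginary unit. Its zeros are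
        the axis points, and the small circle becomes the unit circle about \<open>-t\<close>, which
        encloses 0.\<close>
      define F where "F x = Complex (((x - p) \<bullet> U - (x - p) \<bullet> V * B / D) / A) ((x - p) \<bullet> V / D)" for x
      have contF: "continuous_on S F" for S
        unfolding F_def Complex_eq by (intro continuous_intros) (use A False in auto)
      have F0: "F x \<noteq> 0" if "x \<in> tube C r" for x
      proof
        assume "F x = 0"
        then have "(x - p) \<bullet> V = 0" "(x - p) \<bullet> U = 0" using A False by (auto simp: F_def complex_eq_iff)
        moreover have "x - c = (x - p) + (p - c)" by simp
        ultimately have "(x - c) \<bullet> V = 0" "(x - c) \<bullet> U = 0" using pc by (metis inner_add_left add_0)+
        then show False using avoid that by blast
      qed
      have Floop: "F \<circ> circle_loop c' W X = circlepath (- of_real t) 1"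
      proof
        fix s
        let ?s = "2 * pi * s"
        have d: "circle_loop c' W X s - p = (cos ?s - t) *\<^sub>R W + sin ?s *\<^sub>R X"
          by (simp add: circle_loop_def p_def algebra_simps)
        have "(circle_loop c' W X s - p) \<bullet> U = (cos ?s - t) * A + sin ?s * B"
          "(circle_loop c' W X s - p) \<bullet> V = sin ?s * D"
          unfolding d by (simp_all add: inner_add_left A_def B_def D_def WV)
        then have "F (circle_loop c' W X s) = Complex (cos ?s - t) (sin ?s)"
          using A False by (simp add: F_def)
        also have "\<dots> = circlepath (- of_real t) 1 s"
          unfolding circlepath by (simp add: complex_eq_iff Re_exp Im_exp algebra_simps)
        finally show "(F \<circ> circle_loop c' W X) s = circlepath (- of_real t) 1 s" by simp
      qed
      have "winding_number (F \<circ> circle_loop c' W X) 0 = 0"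
      proof (rule winding_number_nullhomotopic_image[OF hom])
        show "path (circle_loop c' W X)" unfolding path_def circle_loop_def by (intro continuous_intros)
        show "pathfinish (circle_loop c' W X) = pathstart (circle_loop c' W X)"
          by (simp add: pathfinish_def pathstart_def circle_loop_def)
      qed (use CW contF F0 in auto)
      moreover have "winding_number (circlepath (- of_real t) 1) 0 = 1"
        using t t1 by (intro winding_number_circlepath) simp
      ultimately show False by (simp add: Floop)
    qed
  qed
  have "c' + W \<in> tube C r" using inC'[of 0] sub by auto
  then obtain s where s: "dist (c' + W) (c + cos s *\<^sub>R U + sin s *\<^sub>R V) \<le> r"
    by (auto simp: tube_def CU path_image_circle_loop)
  define w where "w = cos s *\<^sub>R U + sin s *\<^sub>R V"
  have "norm w = norm U" by (simp add: w_def norm_frame_combination[OF fU])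
  then have ww: "w \<bullet> w = U \<bullet> U" by (simp add: norm_eq)
  \<comment> \<open>Among the radius vectors of the large circle, \<open>U\<close> has the largest
    scalar product with \<open>U + W\<close>. So \<open>c'\<close> is the circle point nearest to
    \<open>c' + W\<close>, and the norm of \<open>W\<close> is at most \<open>r\<close>.\<close>
  have "(U + W) \<bullet> w = cos s * (U \<bullet> U + W \<bullet> U)"
    using WV UV by (simp add: w_def inner_add_left inner_add_right algebra_simps)
  also have "\<dots> \<le> U \<bullet> U + W \<bullet> U" using pos by simp
  finally have "W \<bullet> W \<le> (U + W - w) \<bullet> (U + W - w)"
    using ww by (simp add: inner_add_left inner_add_right inner_diff_left inner_diff_right inner_commute)
  then have "norm W \<le> norm (U + W - w)" by (simp add: norm_le)
  also have "\<dots> = dist (c' + W) (c + cos s *\<^sub>R U + sin s *\<^sub>R V)"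
    by (simp add: dist_norm c'U w_def algebra_simps)
  finally show ?thesis using s nW by simp
qed

section \<open>Simple chains\<close>

lemma radius_frame_norm_pos: "radius_frame u v \<Longrightarrow> 0 < norm u"
  by (metis radius_frame_def zero_less_norm_iff)

section \<open>Regular polygons inscribed in a circle\<close>

text \<open>The vertices are \<open>2 * pi / q\<close> apart in angle, so rounding finds one within
  half that step of the given direction.\<close>

lemma circle_loop_vertex_near:
  assumes "q > 0"
  obtains i where "i < q" "cos (pi / real q) \<le> cos (2 * pi * (real i / real q) - \<psi>)"
proof -
  define y where "y = \<psi> * real q / (2 * pi)"
  define k where "k = round y"
  \<comment> \<open>The rounded index may be negative or at least \<open>q\<close>; reduction modulo
    \<open>q\<close> changes the angle by full turns only.\<close>
  define i where "i = nat (k mod int q)"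
  have iq: "int i = k mod int q" using assms by (simp add: i_def)
  then have "int i < int q" using assms by simp
  then have "i < q" by simp
  have "k = int q * (k div int q) + int i" using iq by simp
  then have kr: "real_of_int k = real q * of_int (k div int q) + real i"
    by (metis of_int_add of_int_mult of_int_of_nat_eq)
  have q: "real q > 0" using assms by simp
  have "2 * pi * (real i / real q) - \<psi> = 2 * pi / q * (k - y) - 2 * pi * of_int (k div int q)"
    unfolding kr using q by (simp add: y_def field_simps)
  then have "cos (2 * pi * (real i / real q) - \<psi>) = cos (2 * pi / q * (k - y))"
    using cos_int_2pin[of "k div int q"] sin_int_2pin[of "k div int q"] by (simp only: cos_diff)
  moreover have "\<bar>2 * pi / q * (k - y)\<bar> \<le> pi / q"
  proof -
    have "\<bar>k - y\<bar> \<le> 1 / 2" unfolding k_def by (rule of_int_round_abs_le)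
    then have "(2 * pi / q) * \<bar>k - y\<bar> \<le> (2 * pi / q) * (1 / 2)" using q by (intro mult_left_mono) auto
    then show ?thesis by (simp add: abs_mult)
  qed
  then have "cos (pi / q) \<le> cos \<bar>2 * pi / q * (k - y)\<bar>"
    using q assms by (intro cos_monotone_0_pi_le) (auto simp: field_simps)
  then have "cos (pi / q) \<le> cos (2 * pi / q * (k - y))" by (simp only: cos_abs_real)
  ultimately show ?thesis using that[OF \<open>i < q\<close>] by simp
qed

text \<open>A functional separating \<open>x\<close> from the polygon is compared with its value at
  the center: \<open>x\<close> lies below it by at most \<open>m * cos ?h\<close>, where
  \<open>m\<close> measures the functional on the plane of the circle, and some vertex lies below it
  by at least as much.\<close>

lemma polygon_contains_disk:
  fixes c u v :: "real^3" and q :: nat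
  defines "C \<equiv> path_image (circle_loop c u v)"
    and "V \<equiv> (\<lambda>i. circle_loop c u v (real i / real q)) ` {..<q}"
  assumes f: "radius_frame u v" and q: "q \<ge> 3" and r: "0 \<le> r"
    and side: "dist (circle_loop c u v 0) (circle_loop c u v (1 / real q)) \<le> 2 * r"
    and x: "x \<in> convex hull C" and xr: "dist x c \<le> norm u - r"
  shows "x \<in> convex hull V"
proof (rule ccontr)
  assume "x \<notin> convex hull V"
  moreover have "closed (convex hull V)"
    by (intro compact_imp_closed compact_convex_hull finite_imp_compact) (simp add: V_def)
  ultimately obtain a b where ab: "a \<bullet> x < b" "\<And>y. y \<in> convex hull V \<Longrightarrow> b < a \<bullet> y"
    using separating_hyperplane_closed_point[OF convex_convex_hull] by metis
  let ?R = "norm u" and ?h = "pi / real q"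
  have R: "?R > 0" by (rule radius_frame_norm_pos[OF f])
  have h: "0 < ?h" "?h \<le> pi / 2" "?h \<le> pi" using q by (auto simp: field_simps)
  have apothem: "?R - r \<le> ?R * cos ?h"
  proof -
    have "circle_loop c u v 0 - circle_loop c u v (1 / real q) =
        (1 - cos (2 * ?h)) *\<^sub>R u + (- sin (2 * ?h)) *\<^sub>R v"
      by (simp add: circle_loop_def algebra_simps)
    then have "dist (circle_loop c u v 0) (circle_loop c u v (1 / real q)) =
       ?R * sqrt ((1 - cos (2 * ?h))\<^sup>2 + (sin (2 * ?h))\<^sup>2)"
      using norm_frame_combination[OF f, of "1 - cos (2 * ?h)" "- sin (2 * ?h)"]
      unfolding dist_norm by simp
    also have "(1 - cos (2 * ?h))\<^sup>2 + (sin (2 * ?h))\<^sup>2 = (2 * sin ?h)\<^sup>2"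
    proof -
      have alg: "(1 - (1 - 2 * x\<^sup>2))\<^sup>2 + (2 * x * y)\<^sup>2 = 4 * x\<^sup>2 * (x\<^sup>2 + y\<^sup>2)" for x y :: real
        by algebra
      have "cos (2 * ?h) = 1 - 2 * (sin ?h)\<^sup>2" "sin (2 * ?h) = 2 * sin ?h * cos ?h"
        using cos_double_sin sin_double by blast+
      then have "(1 - cos (2 * ?h))\<^sup>2 + (sin (2 * ?h))\<^sup>2
         = 4 * (sin ?h)\<^sup>2 * ((sin ?h)\<^sup>2 + (cos ?h)\<^sup>2)" by (simp only: alg)
      then show ?thesis by (simp add: power_mult_distrib)
    qed
    also have "sqrt ((2 * sin ?h)\<^sup>2) = 2 * sin ?h"
    proof (rule real_sqrt_unique)
      have "0 \<le> sin ?h" by (rule sin_ge_zero) (use h in linarith)+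
      then show "0 \<le> 2 * sin ?h" by simp
    qed simp
    finally have "?R * sin ?h \<le> r" using side by simp
    moreover have "1 - cos ?h \<le> sin ?h"
    proof -
      have s: "0 \<le> sin ?h" "0 \<le> cos ?h" using h by (auto intro!: sin_ge_zero cos_ge_zero)
      have "1 = (sin ?h)\<^sup>2 + (cos ?h)\<^sup>2" by simp
      also have "\<dots> \<le> sin ?h + cos ?h"
        using s by (intro add_mono power_le_one_iff[THEN iffD2] ) (auto simp: power2_eq_square mult_left_le)
      finally show ?thesis by simp
    qed
    then have "?R * (1 - cos ?h) \<le> ?R * sin ?h" using R by (intro mult_left_mono) auto
    ultimately show ?thesis by (simp add: algebra_simps)
  qed
  let ?z = "Complex (a \<bullet> u) (a \<bullet> v)"
  define m where "m = cmod ?z"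
  have m: "m \<ge> 0" by (simp add: m_def)
  have "?z = rcis m (Arg ?z)" by (simp add: rcis_cmod_Arg m_def)
  then have z: "a \<bullet> u = m * cos (Arg ?z)" "a \<bullet> v = m * sin (Arg ?z)"
    by (metis Re_rcis complex.sel(1)) (metis Im_rcis complex.sel(2) \<open>?z = rcis m (Arg ?z)\<close>)
  \<comment> \<open>The functional decreases fastest in the direction opposite to
    \<open>Arg ?z\<close>, hence the shift by \<open>pi\<close>.\<close>
  obtain i where i: "i < q" "cos ?h \<le> cos (2 * pi * (real i / real q) - (Arg ?z + pi))"
    using circle_loop_vertex_near[of q "Arg ?z + pi"] q by auto
  let ?t = "2 * pi * (real i / real q)"
  have "a \<bullet> (circle_loop c u v (real i / real q) - c) = cos ?t * (a \<bullet> u) + sin ?t * (a \<bullet> v)"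
    by (simp add: circle_loop_def inner_add_right)
  also have "\<dots> = m * cos (?t - Arg ?z)"
    by (subst z(1), subst z(2)) (simp add: cos_diff algebra_simps)
  also have "\<dots> = - m * cos (?t - (Arg ?z + pi))"
    using cos_minus_pi[of "?t - Arg ?z"] by (simp add: diff_diff_eq)
  also have "\<dots> \<le> - m * cos ?h" using m i(2) by (simp add: mult_left_mono)
  finally have low: "a \<bullet> (circle_loop c u v (real i / real q) - c) \<le> - m * cos ?h" .
  obtain s t where st: "x = c + s *\<^sub>R u + t *\<^sub>R v"
    using hull_circle_coordinates x C_def by blast
  have xc: "x - c = s *\<^sub>R u + t *\<^sub>R v" by (simp add: st)
  have nx: "norm (x - c) = ?R * sqrt (s\<^sup>2 + t\<^sup>2)" unfolding xc by (rule norm_frame_combination[OF f])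
  have "a \<bullet> (x - c) = s * (a \<bullet> u) + t * (a \<bullet> v)" by (simp add: xc inner_add_right)
  also have "\<dots> = m * ((s, t) \<bullet> (cos (Arg ?z), sin (Arg ?z)))"
    by (subst z(1), subst z(2)) (simp add: algebra_simps)
  also have "\<dots> \<ge> m * - sqrt (s\<^sup>2 + t\<^sup>2)"
  proof (rule mult_left_mono[OF _ m])
    have "\<bar>(s, t) \<bullet> (cos (Arg ?z), sin (Arg ?z))\<bar> \<le> norm (s, t) * norm (cos (Arg ?z), sin (Arg ?z))"
      by (rule Cauchy_Schwarz_ineq2)
    then show "- sqrt (s\<^sup>2 + t\<^sup>2) \<le> (s, t) \<bullet> (cos (Arg ?z), sin (Arg ?z))"
      by (simp add: norm_Pair)
  qed
  finally have "- m * sqrt (s\<^sup>2 + t\<^sup>2) \<le> a \<bullet> (x - c)" by simp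
  moreover have "sqrt (s\<^sup>2 + t\<^sup>2) \<le> cos ?h"
  proof -
    have "?R * sqrt (s\<^sup>2 + t\<^sup>2) \<le> ?R * cos ?h" using nx xr apothem by (simp add: dist_norm)
    then show ?thesis using R by simp
  qed
  then have "- m * cos ?h \<le> - m * sqrt (s\<^sup>2 + t\<^sup>2)" using m by (simp add: mult_left_mono)
  ultimately have "a \<bullet> (circle_loop c u v (real i / real q) - c) \<le> a \<bullet> (x - c)" using low by linarith
  moreover have "circle_loop c u v (real i / real q) \<in> convex hull V"
    using i(1) by (intro hull_inc) (auto simp: V_def)
  ultimately show False using ab by (fastforce simp: inner_diff_right)
qed

text \<open>The points of the disk spanned by the central circle that are at distance at least \<open>r\<close> from
  this circle, \<open>r\<close> being the radius of the tube \<open>T\<close>.\<close>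

definition core :: "(real^3) set \<Rightarrow> (real^3) set" where
  "core T = {x \<in> convex hull central_circle T.
     \<exists>u v r. radius_frame u v \<and> central_circle T = path_image (circle_loop (torus_center T) u v) \<and>
       0 < r \<and> r < norm u \<and> T = tube (central_circle T) r \<and> dist x (torus_center T) \<le> norm u - r}"

lemma coreE:
  assumes "x \<in> core T"
  obtains u v r where "radius_frame u v" "central_circle T = path_image (circle_loop (torus_center T) u v)"
    "0 < r" "r < norm u" "T = tube (central_circle T) r" "dist x (torus_center T) \<le> norm u - r"
    "x \<in> convex hull central_circle T"
  using assms unfolding core_def mem_Collect_eq by (elim conjE exE) (rule that)

lemma torus_center_in_core:
  assumes "standard_solid_torus T"
  shows "torus_center T \<in> core T"
proof -
  obtain u v r where "radius_frame u v" "central_circle T = path_image (circle_loop (torus_center T) u v)"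
    "0 < r" "r < norm u" "T = tube (central_circle T) r"
    using standard_solid_torus_tube[OF assms] by blast
  moreover from this have "torus_center T \<in> convex hull central_circle T"
    by (metis circle_center_in_hull)
  moreover have "dist (torus_center T) (torus_center T) \<le> norm u - r" using \<open>r < norm u\<close> by simp
  ultimately show ?thesis unfolding core_def by blast
qed

lemma hull_circle_dist_le:
  assumes "radius_frame u v" "x \<in> convex hull path_image (circle_loop c u v)"
  shows "dist x c \<le> norm u"
proof -
  have "convex hull path_image (circle_loop c u v) \<subseteq> cball c (norm u)"
    using circle_dist_center[OF assms(1)] by (intro hull_minimal) (auto simp: dist_commute)
  then show ?thesis using assms(2) by (auto simp: dist_commute)
qed

text \<open>The witness is the radial projection of \<open>y\<close>, or any circle point if
  \<open>y\<close> is the center. It converts a lower bound on the distance to the circle into an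
  upper bound on the distance to the center.\<close>

lemma circle_near_point:
  assumes f: "radius_frame u v" and y: "y \<in> convex hull path_image (circle_loop c u v)"
  obtains z where "z \<in> path_image (circle_loop c u v)" "dist y z = norm u - dist y c"
proof (cases "y = c")
  case True
  have "circle_loop c u v 0 \<in> path_image (circle_loop c u v)" by (rule circle_loop_in_path_image)
  with that[OF this] circle_dist_center[OF f this] True show ?thesis by (simp add: dist_commute)
next
  case False
  obtain s t where st: "y = c + s *\<^sub>R u + t *\<^sub>R v" using hull_circle_coordinates y by blast
  let ?z = "Complex s t"
  define k where "k = cmod ?z"
  have "?z = rcis k (Arg ?z)" by (simp add: rcis_cmod_Arg k_def)
  then have z: "s = k * cos (Arg ?z)" "t = k * sin (Arg ?z)"
    by (metis Re_rcis complex.sel(1)) (metis Im_rcis complex.sel(2) \<open>?z = rcis k (Arg ?z)\<close>)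
  define w where "w = cos (Arg ?z) *\<^sub>R u + sin (Arg ?z) *\<^sub>R v"
  have w: "norm w = norm u" by (simp add: w_def norm_frame_combination[OF f])
  have yw: "y - c = k *\<^sub>R w"
    by (subst st, subst z(1), subst z(2)) (simp add: w_def algebra_simps)
  have k: "k \<ge> 0" by (simp add: k_def)
  have "k * norm u \<le> norm u"
    using hull_circle_dist_le[OF f y] by (simp add: dist_norm yw w k)
  then have k1: "k \<le> 1" using radius_frame_norm_pos[OF f] by simp
  have "y - (c + w) = (k - 1) *\<^sub>R w" using yw by (simp add: algebra_simps)
  then have "dist y (c + w) = \<bar>k - 1\<bar> * norm u" by (simp only: dist_norm norm_scaleR w)
  moreover have "dist y c = k * norm u" using k by (simp add: dist_norm yw w)
  ultimately have "dist y (c + w) = norm u - dist y c"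
    using k1 by (simp add: algebra_simps)
  moreover have "c + w \<in> path_image (circle_loop c u v)"
    by (auto simp: w_def path_image_circle_loop add.assoc)
  ultimately show ?thesis using that by blast
qed

text \<open>A point \<open>y\<close> of the second circle in the first disk has depth at least \<open>r + r'\<close> in it, and
  symmetrically for \<open>z\<close>; dividing the segment from \<open>y\<close> to \<open>z\<close> in the ratio \<open>r' : r\<close> leaves enough
  depth in both disks.\<close>

lemma linked_tori_cores_meet:
  assumes T: "standard_solid_torus T" "standard_solid_torus T'" and l: "linked_tori T T'"
  shows "core T \<inter> core T' \<noteq> {}"
proof -
  let ?C = "central_circle T" and ?C' = "central_circle T'" and ?c = "torus_center T" and ?c' = "torus_center T'"
  obtain u v r where t: "radius_frame u v" "?C = path_image (circle_loop ?c u v)"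
    "0 < r" "r < norm u" "T = tube ?C r"
    using standard_solid_torus_tube[OF T(1)] by blast
  obtain u' v' r' where t': "radius_frame u' v'" "?C' = path_image (circle_loop ?c' u' v')"
    "0 < r'" "r' < norm u'" "T' = tube ?C' r'"
    using standard_solid_torus_tube[OF T(2)] by blast
  have dis: "T \<inter> T' = {}" and lc: "linked_circles ?C ?C'"
    using l by (auto simp: linked_tori_def disjnt_def)
  let ?d = "r + r'"
  \<comment> \<open>Otherwise the point dividing the segment from \<open>x\<close> to
    \<open>y\<close> in the ratio \<open>r : r'\<close> would belong to both tubes.\<close>
  have far: "dist x y > ?d" if "x \<in> ?C" "y \<in> ?C'" for x y
  proof (rule ccontr)
    assume "\<not> ?thesis"
    then have le: "norm (y - x) \<le> ?d" by (simp add: dist_norm norm_minus_commute)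
    define p where "p = x + (r / ?d) *\<^sub>R (y - x)"
    have "norm ((r / ?d) *\<^sub>R (y - x)) \<le> (r / ?d) * ?d"
      using t(3) t'(3) le by (simp only: norm_scaleR) (intro mult_mono, auto)
    then have "dist p x \<le> r" using t(3) t'(3) by (simp add: p_def dist_norm)
    moreover have "y - p = (1 - r / ?d) *\<^sub>R (y - x)" by (simp add: p_def algebra_simps)
    moreover have "1 - r / ?d = r' / ?d" using t(3) t'(3) by (simp add: field_simps)
    ultimately have "y - p = (r' / ?d) *\<^sub>R (y - x)" by simp
    moreover have "norm ((r' / ?d) *\<^sub>R (y - x)) \<le> (r' / ?d) * ?d"
      using t(3) t'(3) le by (simp only: norm_scaleR) (intro mult_mono, auto)
    ultimately have "norm (y - p) \<le> r'" using t(3) t'(3) by simp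
    then have "dist p y \<le> r'" by (simp add: dist_norm norm_minus_commute)
    with \<open>dist p x \<le> r\<close> have "p \<in> T \<inter> T'" using t(5) t'(5) that by (auto simp: tube_def)
    then show False using dis by blast
  qed
  obtain y where y: "y \<in> ?C'" "y \<in> convex hull ?C" using linked_circles_meet(2)[OF lc] by blast
  obtain z where z: "z \<in> ?C" "z \<in> convex hull ?C'" using linked_circles_meet(1)[OF lc] by blast
  have yd: "dist y ?c \<le> norm u - ?d"
  proof -
    obtain w where "w \<in> ?C" "dist y w = norm u - dist y ?c"
      using circle_near_point[OF t(1)] y(2) t(2) by metis
    then show ?thesis using far[of w y] y(1) by (simp add: dist_commute)
  qed
  have zd: "dist z ?c' \<le> norm u' - ?d"
  proof -
    obtain w where "w \<in> ?C'" "dist z w = norm u' - dist z ?c'"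
      using circle_near_point[OF t'(1)] z(2) t'(2) by metis
    then show ?thesis using far[of z w] z(1) by simp
  qed
  have zc: "dist z ?c = norm u" and yc: "dist y ?c' = norm u'"
    using circle_dist_center[OF t(1)] circle_dist_center[OF t'(1)] z(1) y(1) t(2) t'(2) by metis+
  \<comment> \<open>Depth is concave on a disk. In the first disk \<open>y\<close> has depth at
    least \<open>?d\<close> and \<open>z\<close> has depth 0, and in the second disk the roles are
    exchanged; the weights thus leave depth \<open>a * ?d = r\<close> and
    \<open>b * ?d = r'\<close>.\<close>
  define a where "a = r / ?d"
  define b where "b = r' / ?d"
  have d0: "?d \<noteq> 0" using t(3) t'(3) by linarith
  have ab: "a \<ge> 0" "b \<ge> 0" "a * ?d = r" "b * ?d = r'"
    using t(3) t'(3) d0 by (simp_all add: a_def b_def)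
  have ab1: "a + b = 1" using d0 by (simp add: a_def b_def flip: add_divide_distrib)
  define w where "w = a *\<^sub>R y + b *\<^sub>R z"
  have dw: "dist w p \<le> a * dist y p + b * dist z p" for p
  proof -
    have "a *\<^sub>R p + b *\<^sub>R p = p" using ab1 by (simp flip: scaleR_add_left)
    then have "w - p = a *\<^sub>R (y - p) + b *\<^sub>R (z - p)" by (simp add: w_def algebra_simps)
    then show ?thesis
      using norm_triangle_ineq[of "a *\<^sub>R (y - p)" "b *\<^sub>R (z - p)"] ab(1,2) by (simp add: dist_norm)
  qed
  have "w \<in> convex hull ?C" "w \<in> convex hull ?C'"
    unfolding w_def using ab(1,2) ab1 y z by (auto intro!: convexD[OF convex_convex_hull] intro: hull_inc)
  moreover have "dist w ?c \<le> norm u - r"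
  proof -
    have "dist w ?c \<le> a * (norm u - ?d) + b * norm u"
      using dw[of ?c] yd ab(1) zc mult_left_mono[OF yd ab(1)] by simp
    also have "\<dots> = (a + b) * norm u - a * ?d" by (simp add: algebra_simps)
    finally show ?thesis by (simp only: ab ab1 mult_1)
  qed
  moreover have "dist w ?c' \<le> norm u' - r'"
  proof -
    have "dist w ?c' \<le> a * norm u' + b * (norm u' - ?d)"
      using dw[of ?c'] zd ab(2) yc mult_left_mono[OF zd ab(2)] by simp
    also have "\<dots> = (a + b) * norm u' - b * ?d" by (simp add: algebra_simps)
    finally show ?thesis by (simp only: ab ab1 mult_1)
  qed
  ultimately have "w \<in> core T" "w \<in> core T'"
    using t t' unfolding core_def by blast+
  then show ?thesis by blast
qed

lemma simple_chainD:
  assumes "simple_chain T q \<tau>"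
  shows simple_chain_torus: "standard_solid_torus T"
    and simple_chain_length: "q \<ge> 3"
    and simple_chain_link: "\<And>i. i < q \<Longrightarrow> standard_solid_torus (\<tau> i)"
    and simple_chain_disjnt: "\<And>i j. i < q \<Longrightarrow> j < q \<Longrightarrow> i \<noteq> j \<Longrightarrow> disjnt (\<tau> i) (\<tau> j)"
    and simple_chain_subset: "\<And>i. i < q \<Longrightarrow> \<tau> i \<subseteq> T"
    and simple_chain_centers: "\<exists>c u v. radius_frame u v \<and> central_circle T = path_image (circle_loop c u v) \<and>
        (\<forall>i<q. torus_center (\<tau> i) = circle_loop c u v (real i / real q))"
    and simple_chain_linked_Suc: "\<And>i. Suc i < q \<Longrightarrow> linked_tori (\<tau> i) (\<tau> (Suc i))"
    and simple_chain_nullhomotopic: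
      "\<And>i. i < q \<Longrightarrow> \<exists>a. homotopic_with_canon (\<lambda>h. True) (central_circle (\<tau> i)) T (\<lambda>x. x) (\<lambda>x. a)"
proof -
  note D = assms[unfolded simple_chain_def]
  show "standard_solid_torus T" using D by (rule conjunct1)
  note D = D[THEN conjunct2]
  show "q \<ge> 3" using D by (rule conjunct1)
  note D = D[THEN conjunct2]
  show "standard_solid_torus (\<tau> i)" if "i < q" for i using D[THEN conjunct1] that by blast
  note D = D[THEN conjunct2]
  show "disjnt (\<tau> i) (\<tau> j)" if "i < q" "j < q" "i \<noteq> j" for i j using D[THEN conjunct1] that by blast
  note D = D[THEN conjunct2, THEN conjunct2]
  show "\<tau> i \<subseteq> T" if "i < q" for i using D[THEN conjunct1] interior_subset[of T] that by blast
  note D = D[THEN conjunct2]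
  show "\<exists>c u v. radius_frame u v \<and> central_circle T = path_image (circle_loop c u v) \<and>
        (\<forall>i<q. torus_center (\<tau> i) = circle_loop c u v (real i / real q))"
    using D by (rule conjunct1)
  note D = D[THEN conjunct2]
  show "linked_tori (\<tau> i) (\<tau> (Suc i))" if "Suc i < q" for i
    using D[THEN conjunct1, rule_format, of i "Suc i"] that by simp
  note D = D[THEN conjunct2]
  show "\<exists>a. homotopic_with_canon (\<lambda>h. True) (central_circle (\<tau> i)) T (\<lambda>x. x) (\<lambda>x. a)" if "i < q" for i
    using D that by blast
qed

lemma core_subset_chain_polygon:
  assumes ch: "simple_chain T q \<tau>"
  shows "core T \<subseteq> convex hull ((\<lambda>i. torus_center (\<tau> i)) ` {..<q})"
proof
  fix x assume x: "x \<in> core T"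
  let ?C = "central_circle T"
  obtain u v r where t: "radius_frame u v" "?C = path_image (circle_loop (torus_center T) u v)"
    "0 < r" "r < norm u" "T = tube ?C r" "dist x (torus_center T) \<le> norm u - r" and xh: "x \<in> convex hull ?C"
    using x by (rule coreE)
  note q = simple_chain_length[OF ch] and st = simple_chain_link[OF ch]
    and sub = simple_chain_subset[OF ch] and hom = simple_chain_nullhomotopic[OF ch]
  obtain c2 u2 v2 where f2: "radius_frame u2 v2" and C2: "?C = path_image (circle_loop c2 u2 v2)"
    and ctr: "\<And>i. i < q \<Longrightarrow> torus_center (\<tau> i) = circle_loop c2 u2 v2 (real i / real q)"
    using simple_chain_centers[OF ch] by (elim exE conjE) simp
  \<comment> \<open>The frame through the chain vertices and the frame of the tube may differ, but
    they describe the same circle and share center and radius.\<close>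
  have c2: "c2 = torus_center T" "norm u2 = norm u"
    by (rule circle_center_radius_unique[OF f2 t(1) trans[OF C2[symmetric] t(2)]])+
  have rad: "dist y (torus_center (\<tau> i)) \<le> r" if i: "i < q" and y: "y \<in> convex hull central_circle (\<tau> i)" for i y
  proof -
    obtain u' v' r' where t': "radius_frame u' v'" "central_circle (\<tau> i) = path_image (circle_loop (torus_center (\<tau> i)) u' v')"
      "0 < r'" "r' < norm u'" "\<tau> i = tube (central_circle (\<tau> i)) r'"
      by (rule standard_solid_torus_tube[OF st[OF i]])
    have "central_circle (\<tau> i) \<subseteq> tube (central_circle (\<tau> i)) r'"
      by (rule subset_tube) (use t'(3) in linarith)
    also have "\<dots> = \<tau> i" using t'(5) by (rule sym)
    also note sub[OF i]
    finally have sT: "central_circle (\<tau> i) \<subseteq> T" .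
    have cT: "torus_center (\<tau> i) \<in> ?C" unfolding C2 ctr[OF i] by (rule circle_loop_in_path_image)
    obtain a where a: "homotopic_with_canon (\<lambda>h. True) (central_circle (\<tau> i)) T (\<lambda>x. x) (\<lambda>x. a)"
      using hom[OF i] ..
    have "norm u' \<le> r"
    proof (rule nullhomotopic_circle_radius[OF t(1) t'(1) t(3,4)])
      show "torus_center (\<tau> i) \<in> path_image (circle_loop (torus_center T) u v)"
        using cT unfolding t(2) .
      show "path_image (circle_loop (torus_center (\<tau> i)) u' v') \<subseteq> tube (path_image (circle_loop (torus_center T) u v)) r"
        using sT unfolding t(2)[symmetric] t'(2)[symmetric] t(5)[symmetric] .
      show "homotopic_with_canon (\<lambda>h. True) (path_image (circle_loop (torus_center (\<tau> i)) u' v'))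
          (tube (path_image (circle_loop (torus_center T) u v)) r) (\<lambda>x. x) (\<lambda>x. a)"
        using a unfolding t(2)[symmetric] t'(2)[symmetric] t(5)[symmetric] .
    qed
    moreover have "dist y (torus_center (\<tau> i)) \<le> norm u'"
      by (rule hull_circle_dist_le[OF t'(1)]) (use y in \<open>simp only: t'(2)[symmetric]\<close>)
    ultimately show ?thesis by simp
  qed
  \<comment> \<open>All sides of the regular polygon are equal, so the links 0 and 1 give the bound:
    a common point of their disks is within \<open>r\<close> of both centers.\<close>
  have i01: "0 < q" "1 < q" using q by auto
  have "linked_tori (\<tau> 0) (\<tau> 1)" using simple_chain_linked_Suc[OF ch, of 0] i01 by simp
  then obtain y where "y \<in> convex hull central_circle (\<tau> 0)" "y \<in> convex hull central_circle (\<tau> 1)"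
    unfolding linked_tori_def using linked_circles_meet(1)[of "central_circle (\<tau> 0)" "central_circle (\<tau> 1)"]
      hull_inc[of _ "central_circle (\<tau> 0)" convex] by blast
  then have "dist y (torus_center (\<tau> 0)) \<le> r" "dist y (torus_center (\<tau> 1)) \<le> r"
    using rad i01 by blast+
  then have "dist (torus_center (\<tau> 0)) (torus_center (\<tau> 1)) \<le> 2 * r"
    using dist_triangle[of "torus_center (\<tau> 0)" "torus_center (\<tau> 1)" y] by (simp add: dist_commute)
  then have side: "dist (circle_loop c2 u2 v2 0) (circle_loop c2 u2 v2 (1 / real q)) \<le> 2 * r"
    using ctr[OF i01(1)] ctr[OF i01(2)] by simp
  have xn: "dist x c2 \<le> norm u2 - r" using t(6) unfolding c2 .
  have "x \<in> convex hull ((\<lambda>i. circle_loop c2 u2 v2 (real i / real q)) ` {..<q})"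
  proof (rule polygon_contains_disk[OF f2 q _ side])
    show "x \<in> convex hull path_image (circle_loop c2 u2 v2)" using xh unfolding C2 .
  qed (use t(3) xn in linarith)+
  also have "(\<lambda>i. circle_loop c2 u2 v2 (real i / real q)) ` {..<q} = (\<lambda>i. torus_center (\<tau> i)) ` {..<q}"
    using ctr by (intro image_cong) auto
  finally show "x \<in> convex hull ((\<lambda>i. torus_center (\<tau> i)) ` {..<q})" .
qed

lemma central_circle_subset:
  assumes "standard_solid_torus T"
  shows "central_circle T \<subseteq> T"
proof -
  obtain u v r where "0 < r" "T = tube (central_circle T) r"
    by (rule standard_solid_torus_tube[OF assms])
  note t = this
  have "central_circle T \<subseteq> tube (central_circle T) r" by (rule subset_tube) (use t(1) in simp)
  also have "\<dots> = T" using t(2) by (rule sym)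
  finally show ?thesis .
qed

lemma standard_solid_torus_nonempty:
  assumes "standard_solid_torus T"
  shows "T \<noteq> {}"
proof -
  obtain u v where "central_circle T = path_image (circle_loop (torus_center T) u v)"
    by (rule standard_solid_torus_tube[OF assms])
  then have "central_circle T \<noteq> {}" using circle_loop_in_path_image by blast
  then show ?thesis using central_circle_subset[OF assms] by blast
qed

lemma core_subset_hull: "standard_solid_torus T \<Longrightarrow> core T \<subseteq> convex hull T"
  using hull_mono[OF central_circle_subset] by (fastforce simp: core_def)

text \<open>The core contains the center and, because \<open>r\<close> is less than the radius, a
  further point of each radius. An affine function with equal values at these two points is constant
  along the radius.\<close>

lemma constant_on_core_imp_constant_on_circle:
  assumes T: "standard_solid_torus T" and const: "\<And>x. x \<in> core T \<Longrightarrow> a \<bullet> x = b" and y: "y \<in> central_circle T"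
  shows "a \<bullet> y = b"
proof -
  let ?C = "central_circle T" and ?c = "torus_center T"
  obtain u v r where t: "radius_frame u v" "?C = path_image (circle_loop ?c u v)"
    "0 < r" "r < norm u" "T = tube ?C r"
    by (rule standard_solid_torus_tube[OF T])
  define s where "s = (norm u - r) / norm u"
  have u: "0 < norm u" using t(3,4) by linarith
  have s: "0 < s" "s \<le> 1" using t(3,4) u unfolding s_def by (simp_all add: divide_le_eq)
  define p where "p = (1 - s) *\<^sub>R ?c + s *\<^sub>R y"
  have cc: "?c \<in> convex hull ?C" unfolding t(2) by (rule circle_center_in_hull)
  have "p \<in> convex hull ?C"
    unfolding p_def using s cc hull_inc[OF y] by (intro convexD[OF convex_convex_hull]) auto
  moreover have "dist p ?c \<le> norm u - r"
  proof -
    have "p - ?c = s *\<^sub>R (y - ?c)" by (simp add: p_def algebra_simps)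
    moreover have "dist y ?c = norm u" by (rule circle_dist_center[OF t(1) y[unfolded t(2)]])
    ultimately have "dist p ?c = s * norm u" using s by (simp add: dist_norm)
    also have "\<dots> = norm u - r" using u by (simp add: s_def)
    finally show ?thesis by simp
  qed
  ultimately have "p \<in> core T" using t unfolding core_def by blast
  then have "a \<bullet> p = b" by (rule const)
  moreover have "a \<bullet> ?c = b" by (rule const) (rule torus_center_in_core[OF T])
  ultimately have "s * (a \<bullet> y) = s * b" by (simp add: p_def inner_add_right algebra_simps)
  then show ?thesis using s by simp
qed

section \<open>Links as components of the next stage\<close>

text \<open>A connected subset of \<open>S'\<close> containing the link stays in the component
  \<open>T\<close>, and there it cannot reach the other links, which form a disjoint closed set. The
  chain condition speaks of components, so this is what allows it to be applied again to each
  link.\<close>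

lemma chain_link_component:
  assumes T: "T \<in> components S" and sub: "S' \<subseteq> S" and ch: "simple_chain T q \<tau>"
    and eq: "S' \<inter> T = (\<Union>j<q. \<tau> j)" and i: "i < q"
  shows "\<tau> i \<in> components S'"
proof -
  have st: "standard_solid_torus (\<tau> j)" if "j < q" for j using simple_chain_link[OF ch that] .
  have "d = \<tau> i" if d: "\<tau> i \<subseteq> d" "d \<subseteq> S'" "connected d" for d
  proof -
    have ne: "\<tau> i \<noteq> {}" using standard_solid_torus_nonempty st i by blast
    have "T \<inter> d \<noteq> {}" using ne d(1) eq i by blast
    then have "d \<subseteq> T" using components_maximal[OF T d(3)] d(2) sub by blast
    then have dU: "d \<subseteq> \<tau> i \<union> (\<Union>j\<in>{..<q}-{i}. \<tau> j)" using d(2) eq by blast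
    have cl: "closed (\<tau> j)" if "j < q" for j
      by (rule compact_imp_closed[OF standard_solid_torus_compact[OF st[OF that]]])
    then have "closed (\<tau> i)" "closed (\<Union>j\<in>{..<q}-{i}. \<tau> j)"
      using i by (auto intro: closed_UN)
    moreover have "\<tau> i \<inter> (\<Union>j\<in>{..<q}-{i}. \<tau> j) \<inter> d = {}"
      using simple_chain_disjnt[OF ch i] by (fastforce simp: disjnt_def)
    ultimately have "\<tau> i \<inter> d = {} \<or> (\<Union>j\<in>{..<q}-{i}. \<tau> j) \<inter> d = {}"
      using connected_closedD[OF d(3) _ dU] by blast
    then show ?thesis using ne d(1) dU by blast
  qed
  moreover have "\<tau> i \<subseteq> S'" using eq i by blast
  ultimately show ?thesis
    unfolding in_components_maximal
    using standard_solid_torus_nonempty standard_solid_torus_connected st[OF i] by blast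
qed

lemma connected_chain_Union:
  assumes "\<And>j. j < q \<Longrightarrow> connected (S j)" and "\<And>j. Suc j < q \<Longrightarrow> S j \<inter> S (Suc j) \<noteq> {}"
  shows "connected (\<Union>j<q. S j)"
  using assms
proof (induction q)
  case (Suc q)
  have c: "connected (\<Union>j<q. S j)" using Suc by simp
  show ?case
  proof (cases q)
    case (Suc p)
    then have "S p \<inter> S q \<noteq> {}" using Suc.prems(2)[of p] by simp
    then have "(\<Union>j<q. S j) \<inter> S q \<noteq> {}" using Suc by auto
    then have "connected ((\<Union>j<q. S j) \<union> S q)" using c Suc.prems(1)[of q] by (intro connected_Un) auto
    then show ?thesis by (simp add: lessThan_Suc Un_commute)
  qed (use Suc.prems(1)[of 0] in \<open>simp add: lessThan_Suc\<close>)
qed simp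

section \<open>Necklaces and their projections\<close>

locale torus_stages =
  fixes M :: "nat \<Rightarrow> (real^3) set"
  assumes compact_stage: "i \<ge> 1 \<Longrightarrow> compact (M i)"
    and stage_Suc: "i \<ge> 1 \<Longrightarrow> M (Suc i) \<subseteq> M i"
    and chain: "i \<ge> 1 \<Longrightarrow> T \<in> components (M i) \<Longrightarrow>
      \<exists>q \<tau>. simple_chain T q \<tau> \<and> M (Suc i) \<inter> T = (\<Union>j<q. \<tau> j)"
begin

lemma stage_add:
  assumes "i \<ge> 1" shows "M (i + k) \<subseteq> M i"
proof (induction k)
  case (Suc k)
  have "M (Suc (i + k)) \<subseteq> M (i + k)" using assms by (intro stage_Suc) simp
  with Suc show ?case by simp
qed simp

lemma component_subset: "T \<in> components (M i) \<Longrightarrow> T \<subseteq> M i"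
  by (rule in_components_subset)

lemma chainE:
  assumes "i \<ge> 1" "T \<in> components (M i)"
  obtains q \<tau> where "simple_chain T q \<tau>" "\<And>j. j < q \<Longrightarrow> \<tau> j \<in> components (M (Suc i))"
    "\<And>k. M (Suc i + k) \<inter> T = (\<Union>j<q. M (Suc i + k) \<inter> \<tau> j)"
proof -
  obtain q \<tau> where c: "simple_chain T q \<tau>" "M (Suc i) \<inter> T = (\<Union>j<q. \<tau> j)"
    using chain[OF assms] by (elim exE conjE)
  have "\<tau> j \<in> components (M (Suc i))" if "j < q" for j
    by (rule chain_link_component[OF assms(2) stage_Suc[OF assms(1)] c that])
  moreover have "M (Suc i + k) \<inter> T = (\<Union>j<q. M (Suc i + k) \<inter> \<tau> j)" for k
    using c(2) stage_add[of "Suc i" k] by fastforce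
  ultimately show ?thesis using that c(1) by blast
qed

lemma component_torus: "i \<ge> 1 \<Longrightarrow> T \<in> components (M i) \<Longrightarrow> standard_solid_torus T"
  by (erule (1) chainE) (rule simple_chain_torus)

text \<open>The number \<open>k\<close> of further stages decreases while \<open>i\<close> and
  \<open>T\<close> vary, so the hypothesis applies to the links of \<open>T\<close>. It is used at
  their centers, which lie in the cores; the polygon spanned by these covers the core of
  \<open>T\<close>.\<close>

lemma core_subset_hull_stage:
  assumes "i \<ge> 1" "T \<in> components (M i)"
  shows "core T \<subseteq> convex hull (M (i + k) \<inter> T)"
  using assms
proof (induction k arbitrary: i T)
  case 0
  then have "M (i + 0) \<inter> T = T" using component_subset[of T i] by auto
  then show ?case using core_subset_hull component_torus 0 by simp
next
  case (Suc k)
  obtain q \<tau> where c: "simple_chain T q \<tau>" "\<And>j. j < q \<Longrightarrow> \<tau> j \<in> components (M (Suc i))"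
    "M (Suc i + k) \<inter> T = (\<Union>j<q. M (Suc i + k) \<inter> \<tau> j)"
    by (rule chainE[OF Suc.prems]) blast
  have "torus_center (\<tau> j) \<in> convex hull (M (Suc i + k) \<inter> T)" if j: "j < q" for j
  proof -
    have "torus_center (\<tau> j) \<in> core (\<tau> j)" by (rule torus_center_in_core[OF simple_chain_link[OF c(1) j]])
    also have "\<dots> \<subseteq> convex hull (M (Suc i + k) \<inter> \<tau> j)" by (rule Suc.IH[OF _ c(2)[OF j]]) simp
    also have "\<dots> \<subseteq> convex hull (M (Suc i + k) \<inter> T)" unfolding c(3) by (rule hull_mono) (use j in blast)
    finally show ?thesis .
  qed
  then have "convex hull ((\<lambda>j. torus_center (\<tau> j)) ` {..<q}) \<subseteq> convex hull (M (Suc i + k) \<inter> T)"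
    by (intro hull_minimal convex_convex_hull) blast
  then show ?case using core_subset_chain_polygon[OF c(1)] by simp
qed

text \<open>Linear maps commute with convex hulls, and a convex image is its own hull.\<close>

lemma inner_hull_in_image:
  assumes "convex ((\<bullet>) a ` X)" "x \<in> convex hull X"
  shows "a \<bullet> x \<in> (\<bullet>) a ` X"
proof -
  have "(\<bullet>) a ` (convex hull X) = convex hull ((\<bullet>) a ` X)"
    by (rule convex_hull_linear_image) (rule bounded_linear.linear[OF bounded_linear_inner_right])
  then show ?thesis using assms by (metis convex_hull_eq imageI)
qed

lemma convex_image_stage:
  fixes a :: "real^3"
  assumes "i \<ge> 1" "T \<in> components (M i)"
  shows "convex ((\<bullet>) a ` (M (i + k) \<inter> T))"
  using assms
proof (induction k arbitrary: i T)
  case 0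
  then have "M (i + 0) \<inter> T = T" using component_subset[of T i] by auto
  moreover have "connected T" using standard_solid_torus_connected component_torus 0 by blast
  then have "connected ((\<bullet>) a ` T)" by (intro connected_continuous_image continuous_intros)
  ultimately show ?case by (simp add: is_interval_connected_1 is_interval_convex_1[symmetric])
next
  case (Suc k)
  obtain q \<tau> where c: "simple_chain T q \<tau>" "\<And>j. j < q \<Longrightarrow> \<tau> j \<in> components (M (Suc i))"
    "M (Suc i + k) \<inter> T = (\<Union>j<q. M (Suc i + k) \<inter> \<tau> j)"
    by (rule chainE[OF Suc.prems]) blast
  let ?S = "\<lambda>j. (\<bullet>) a ` (M (Suc i + k) \<inter> \<tau> j)"
  have cv: "convex (?S j)" if "j < q" for j by (rule Suc.IH[OF _ c(2)[OF that]]) simp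
  have "?S j \<inter> ?S (Suc j) \<noteq> {}" if j: "Suc j < q" for j
  proof -
    have j': "j < q" using j by simp
    obtain w where w: "w \<in> core (\<tau> j)" "w \<in> core (\<tau> (Suc j))"
      using linked_tori_cores_meet[OF simple_chain_link[OF c(1) j'] simple_chain_link[OF c(1) j] simple_chain_linked_Suc[OF c(1) j]]
      by blast
    have "w \<in> convex hull (M (Suc i + k) \<inter> \<tau> j)" "w \<in> convex hull (M (Suc i + k) \<inter> \<tau> (Suc j))"
      using core_subset_hull_stage[OF _ c(2)[OF j'], of k] core_subset_hull_stage[OF _ c(2)[OF j], of k] w by auto
    \<comment> \<open>\<open>w\<close> is only in the two hulls; the induction hypothesis, convexity
      of the two images, turns its value into one attained on both parts.\<close>
    then have "a \<bullet> w \<in> ?S j" "a \<bullet> w \<in> ?S (Suc j)"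
      using inner_hull_in_image cv j j' by blast+
    then show ?thesis by blast
  qed
  then have "connected (\<Union>j<q. ?S j)" using cv by (intro connected_chain_Union convex_connected)
  moreover have "(\<bullet>) a ` (M (i + Suc k) \<inter> T) = (\<Union>j<q. ?S j)"
    unfolding add_Suc_right add_Suc[symmetric] c(3) by (rule image_UN)
  ultimately show ?case by (simp add: is_interval_connected_1 is_interval_convex_1[symmetric])
qed

text \<open>Image and intersection commute here by compactness: the slices of the stages by the
  hyperplane of value \<open>y\<close> are nested, compact and nonempty.\<close>

lemma image_limit:
  fixes a :: "real^3"
  assumes i: "i \<ge> 1" and T: "T \<in> components (M i)"
  shows "(\<bullet>) a ` ((\<Inter>j\<in>{1..}. M j) \<inter> T) = (\<Inter>k. (\<bullet>) a ` (M (i + k) \<inter> T))"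
proof (intro equalityI subsetI)
  fix y assume y: "y \<in> (\<Inter>k. (\<bullet>) a ` (M (i + k) \<inter> T))"
  define F where "F k = M (i + k) \<inter> T \<inter> {x. a \<bullet> x = y}" for k
  have "\<Inter> (range F) \<noteq> {}"
  proof (rule compact_nest)
    show "compact (F k)" for k
      unfolding F_def
      by (intro compact_Int_closed compact_Int closed_hyperplane compact_stage
            standard_solid_torus_compact component_torus[OF i T]) (use i in simp)
    show "F k \<noteq> {}" for k using y by (auto simp: F_def)
    show "F n \<subseteq> F m" if "m \<le> n" for m n
      using stage_add[of "i + m" "n - m"] i that by (auto simp: F_def)
  qed
  then obtain x where x: "\<And>k. x \<in> M (i + k)" "x \<in> T" "a \<bullet> x = y" by (auto simp: F_def)
  have "x \<in> M j" if "j \<ge> 1" for j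
    using stage_add[OF that, of i] x(1)[of j] by (auto simp: add.commute)
  then show "y \<in> (\<bullet>) a ` ((\<Inter>j\<in>{1..}. M j) \<inter> T)" using x by auto
qed (use i in auto)

lemma convex_image_limit:
  assumes "i \<ge> 1" "T \<in> components (M i)"
  shows "convex ((\<bullet>) a ` ((\<Inter>j\<in>{1..}. M j) \<inter> T))"
  unfolding image_limit[OF assms] by (intro convex_INT convex_image_stage assms)

lemma core_image_limit:
  assumes "i \<ge> 1" "T \<in> components (M i)" "x \<in> core T"
  shows "a \<bullet> x \<in> (\<bullet>) a ` ((\<Inter>j\<in>{1..}. M j) \<inter> T)"
  unfolding image_limit[OF assms(1,2)]
  using inner_hull_in_image[OF convex_image_stage[OF assms(1,2)]] core_subset_hull_stage[OF assms(1,2)] assms(3)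
  by blast

text \<open>Every value on the core of a link is attained on the limit set, so a functional constant
  on the limit set is constant on the cores, hence on the circles, of two linked links.\<close>

lemma limit_not_coplanar:
  assumes T: "i \<ge> 1" "T \<in> components (M i)" and a: "a \<noteq> 0" and const: "\<And>x. x \<in> (\<Inter>j\<in>{1..}. M j) \<Longrightarrow> a \<bullet> x = b"
  shows False
proof -
  obtain q \<tau> where c: "simple_chain T q \<tau>" "\<And>j. j < q \<Longrightarrow> \<tau> j \<in> components (M (Suc i))"
    by (rule chainE[OF T]) (rule that)
  have q: "0 < q" "Suc 0 < q" using simple_chain_length[OF c(1)] by auto
  have circ: "a \<bullet> y = b" if j: "j < q" and y: "y \<in> central_circle (\<tau> j)" for j y
  proof (rule constant_on_core_imp_constant_on_circle[OF simple_chain_link[OF c(1) j] _ y])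
    fix x assume "x \<in> core (\<tau> j)"
    then have "a \<bullet> x \<in> (\<bullet>) a ` ((\<Inter>j\<in>{1..}. M j) \<inter> \<tau> j)"
      by (intro core_image_limit[OF _ c(2)[OF j]]) auto
    then show "a \<bullet> x = b" using const by auto
  qed
  have "linked_circles (central_circle (\<tau> 0)) (central_circle (\<tau> (Suc 0)))"
    using simple_chain_linked_Suc[OF c(1) q(2)] unfolding linked_tori_def by (rule conjunct2)
  then show False
    by (rule linked_circles_not_coplanar[OF _ a]) (use circ[OF q(1)] circ[OF q(2)] in \<open>elim UnE; simp\<close>)
qed

end

section \<open>Projections onto lines and the convex body of a necklace\<close>

lemma antoine_necklace_stages:
  assumes "antoine_necklace A"
  obtains M where "torus_stages M" "A = (\<Inter>i\<in>{1..}. M i)" "standard_solid_torus (M 1)"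
proof -
  obtain M :: "nat \<Rightarrow> (real^3) set" where M: "A = (\<Inter>i\<in>{1..}. M i)"
    "\<forall>i\<ge>1. \<exists>F. finite F \<and> pairwise disjnt F \<and> (\<forall>T\<in>F. standard_solid_torus T) \<and> M i = \<Union>F"
    "standard_solid_torus (M 1)"
    "\<forall>i\<ge>1. M (i + 1) \<subseteq> interior (M i)"
    "\<forall>i\<ge>1. \<forall>T\<in>components (M i). \<exists>q \<tau>. simple_chain T q \<tau> \<and> M (i + 1) \<inter> T = (\<Union>j<q. \<tau> j)"
    using assms unfolding antoine_necklace_def by (elim conjE exE)
  have "torus_stages M"
  proof
    fix i :: nat assume i: "i \<ge> 1"
    show "compact (M i)"
    proof -
      obtain F where F: "finite F" "\<forall>T\<in>F. standard_solid_torus T" "M i = \<Union>F"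
        using M(2)[rule_format, OF i] by (elim exE conjE)
      show ?thesis unfolding F(3) by (rule compact_Union[OF F(1)]) (rule standard_solid_torus_compact[OF F(2)[rule_format]])
    qed
    show "M (Suc i) \<subseteq> M i" using subset_trans[OF M(4)[rule_format, OF i] interior_subset] by simp
    show "\<exists>q \<tau>. simple_chain T q \<tau> \<and> M (Suc i) \<inter> T = (\<Union>j<q. \<tau> j)" if "T \<in> components (M i)" for T
      using M(5)[rule_format, OF i that] by simp
  qed
  then show ?thesis using that M(1,3) by blast
qed

lemma orth_proj_line:
  assumes n: "norm n = 1" and l: "l = range (\<lambda>t. p + t *\<^sub>R n)"
  shows "orth_proj l x = p + (n \<bullet> x - n \<bullet> p) *\<^sub>R n"
  unfolding orth_proj_def
proof (rule the_equality)
  have nn: "n \<bullet> n = 1" using n by (simp add: norm_eq_1)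
  have k: "n \<bullet> (x - (p + (n \<bullet> x - n \<bullet> p) *\<^sub>R n)) = 0" by (simp add: inner_diff_right inner_add_right nn)
  show "p + (n \<bullet> x - n \<bullet> p) *\<^sub>R n \<in> l \<and> (\<forall>z\<in>l. orthogonal (x - (p + (n \<bullet> x - n \<bullet> p) *\<^sub>R n)) (z - (p + (n \<bullet> x - n \<bullet> p) *\<^sub>R n)))"
  proof (intro conjI ballI)
    fix z assume "z \<in> l"
    then obtain t where "z = p + t *\<^sub>R n" using l by blast
    then have z: "z - (p + (n \<bullet> x - n \<bullet> p) *\<^sub>R n) = (t - (n \<bullet> x - n \<bullet> p)) *\<^sub>R n" by (simp add: algebra_simps)
    show "orthogonal (x - (p + (n \<bullet> x - n \<bullet> p) *\<^sub>R n)) (z - (p + (n \<bullet> x - n \<bullet> p) *\<^sub>R n))"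
      using k by (simp only: z orthogonal_def inner_scaleR_right inner_commute[of _ n] mult_zero_right)
  qed (use l in blast)
  fix y assume y: "y \<in> l \<and> (\<forall>z\<in>l. orthogonal (x - y) (z - y))"
  then obtain s where s: "y = p + s *\<^sub>R n" using l by blast
  \<comment> \<open>For uniqueness, the orthogonality condition is tested on the point one unit
    beyond \<open>y\<close>, where \<open>z - y\<close> is \<open>n\<close>.\<close>
  have "p + (s + 1) *\<^sub>R n \<in> l" using l by blast
  then have "orthogonal (x - y) (p + (s + 1) *\<^sub>R n - y)" using y by blast
  moreover have "p + (s + 1) *\<^sub>R n - y = n" by (simp add: s algebra_simps)
  ultimately have "n \<bullet> (x - y) = 0" by (simp only: orthogonal_def inner_commute)
  then have "s = n \<bullet> x - n \<bullet> p" by (simp add: s inner_diff_right inner_add_right nn)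
  then show "y = p + (n \<bullet> x - n \<bullet> p) *\<^sub>R n" by (simp add: s)
qed

theorem corollary2p7:
  fixes A :: "(real^3) set"
  assumes "antoine_necklace A"
  shows "\<exists>K. convex_body K \<and> (\<forall>l. straight_line l \<longrightarrow> orth_proj l ` A = orth_proj l ` K)"
proof -
  obtain M where tm: "torus_stages M" and A: "A = (\<Inter>i\<in>{1..}. M i)" and M1: "standard_solid_torus (M 1)"
    by (rule antoine_necklace_stages[OF assms])
  interpret torus_stages M by (rule tm)
  \<comment> \<open>The first stage is a single connected torus, so the statements about a component
    of a stage, taken for \<open>M 1\<close>, concern all of \<open>A\<close>.\<close>
  have comp: "M 1 \<in> components (M 1)"
    unfolding in_components_maximal
    using standard_solid_torus_nonempty[OF M1] standard_solid_torus_connected[OF M1] by blast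
  have AM: "A \<inter> M 1 = A" unfolding A by auto
  have cv: "convex ((\<bullet>) a ` A)" for a
    using convex_image_limit[OF le_refl comp, of a] unfolding A[symmetric] AM .
  have "closed A" unfolding A by (intro closed_INT ballI compact_imp_closed compact_stage) simp
  then have "compact (M 1 \<inter> A)" using compact_stage[OF le_refl] by (intro compact_Int_closed)
  then have "compact A" using AM by (simp add: Int_commute)
  then have cK: "compact (convex hull A)" by (rule compact_convex_hull)
  have "interior (convex hull A) \<noteq> {}"
  proof
    assume "interior (convex hull A) = {}"
    then obtain a b where a: "a \<noteq> 0" "convex hull A \<subseteq> {x. a \<bullet> x = b}"
      using empty_interior_subset_hyperplane[OF convex_convex_hull] by blast
    have "a \<bullet> x = b" if "x \<in> (\<Inter>j\<in>{1..}. M j)" for x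
      using a(2) hull_subset[of A convex] that unfolding A[symmetric] by blast
    then show False by (rule limit_not_coplanar[OF le_refl comp a(1)])
  qed
  with cK have "convex_body (convex hull A)" unfolding convex_body_def by (simp add: convex_convex_hull)
  moreover have "orth_proj l ` A = orth_proj l ` (convex hull A)" if sl: "straight_line l" for l
  proof -
    obtain p n where n: "norm n = 1" "l = range (\<lambda>t. p + t *\<^sub>R n)" by (rule straight_line_param[OF sl])
    \<comment> \<open>Projection onto the line factors through the functional given by its direction
      \<open>n\<close>, so equality of the images under this functional suffices.\<close>
    have proj: "orth_proj l ` S = (\<lambda>s. p + (s - n \<bullet> p) *\<^sub>R n) ` ((\<bullet>) n ` S)" for S
      by (simp add: orth_proj_line[OF n] image_image)
    have "(\<bullet>) n ` A = (\<bullet>) n ` (convex hull A)"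
      using inner_hull_in_image[OF cv] hull_subset[of A convex] by blast
    then show ?thesis by (simp only: proj)
  qed
  ultimately show ?thesis by blast
qed

end
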